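(* Let $\mathbb{F}_q$ be a finite field of order $q=p^s$ with $p$ prime. Let $P_1,\dots,P_r \in \mathbb{F}_q[t_1,\dots,t_n]$ be nonzero polynomials, and let $\mathcal{I}\subseteq\{1,\dots,n\}$ be a nonempty subset such that $\max_{1\le j\le r}\deg_{\mathcal{I}}(P_j)>0$. Let $f_1,\dots,f_n \in \mathbb{F}_q[t]$ and assume that $f_i$ is nonconstant for all $i\in\mathcal{I}$. Suppose that $(q-1)\sum_{j=1}^r \deg_{\mathcal{I}}(P_j) < \sum_{i\in\mathcal{I}} \omega(f_i)$. Then \[ q^{\left\lceil\left(\sum_{i\in\mathcal{I}} \frac{\omega(f_i)}{q-1}-\sum_{j=1}^r \deg_{\mathcal{I}}(P_j)\right)/\max_{1\le j\le r}\deg_{\mathcal{I}}(P_j)\right\rceil} \] divides $\# \{ (x_1,\dots,x_n) \in \mathbb{F}_q^n \mid P_j(f_1(x_1),\dots,f_n(x_n)) = 0 \text{ for all } 1 \leq j \leq r\}$.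
   Context: For nonconstant $f\in\mathbb{F}_q[t]$, write $f(t)=\sum_{\ell=1}^R b_{\ell}t^{m_{\ell}}$ with $b_{\ell}\neq 0$ and pairwise distinct exponents $m_\ell\geq 0$, and define $\omega(f)= \min\{\sum_{\ell=1}^R \gamma_{\ell} \mid 0\le\gamma_1,\dots,\gamma_R\le q-1 \text{ integers and } \sum_{\ell=1}^R m_{\ell}\gamma_{\ell}\in (q-1)\mathbb{Z}^+\}$ (one has $1\le\omega(f)\le q-1$). For nonempty $\mathcal{I}\subseteq\{1,\dots,n\}$ and a monomial $a t_1^{m_1}\cdots t_n^{m_n}$ with $a\neq 0$, its $\mathcal{I}$-degree is $\sum_{i\in\mathcal{I}} m_i$; for $P\in\mathbb{F}_q[t_1,\dots,t_n]$, $\deg_{\mathcal{I}}(P)$ is the maximum of the $\mathcal{I}$-degrees of its monomial terms. *)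

theory Defs
  imports
    "HOL-Library.Poly_Mapping"
    "HOL-Library.Cardinality"
    "HOL-Computational_Algebra.Computational_Algebra"
begin

text \<open>
  The ring of polynomials in variables indexed by a finite type \<open>'n\<close> with coefficients
  in \<open>'a\<close>: a finitely supported map from exponent vectors to coefficients.  Its ring
  structure (convolution product) is the one provided by the theory of polynomial mappings.
\<close>

type_synonym ('n, 'a) mpoly = "('n \<Rightarrow>\<^sub>0 nat) \<Rightarrow>\<^sub>0 'a"

definition mpoly_eval :: "('n::finite, 'a::comm_semiring_1) mpoly \<Rightarrow> ('n \<Rightarrow> 'a) \<Rightarrow> 'a" where
  "mpoly_eval P x =
     (\<Sum>m\<in>Poly_Mapping.keys P.
        Poly_Mapping.lookup P m * (\<Prod>i\<in>UNIV. x i ^ Poly_Mapping.lookup m i))"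

text \<open>Meaningful only for \<open>P \<noteq> 0\<close>; otherwise the maximum is over the empty set.\<close>

definition deg_on :: "'n::finite set \<Rightarrow> ('n, 'a::zero) mpoly \<Rightarrow> nat" where
  "deg_on I P = Max ((\<lambda>m. \<Sum>i\<in>I. Poly_Mapping.lookup m i) ` Poly_Mapping.keys P)"

definition exponents :: "'a::zero poly \<Rightarrow> nat set" where
  "exponents f = {m. coeff f m \<noteq> 0}"

text \<open>
  The integers \<open>\<gamma>\<^sub>\<ell>\<close> are indexed by the exponents \<open>m\<^sub>\<ell>\<close> themselves, which are pairwise
  distinct; values of \<open>\<gamma>\<close> off the support of \<open>f\<close> play no role.
\<close>

definition omega_sums :: "'a::{field,finite} poly \<Rightarrow> nat set" where
  "omega_sums f =
     {(\<Sum>m\<in>exponents f. \<gamma> m) | \<gamma> :: nat \<Rightarrow> nat.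
        (\<forall>m\<in>exponents f. \<gamma> m \<le> CARD('a) - 1) \<and>
        (\<exists>k>0. (\<Sum>m\<in>exponents f. m * \<gamma> m) = (CARD('a) - 1) * k)}"

definition omega :: "'a::{field,finite} poly \<Rightarrow> nat" where
  "omega f = Min (omega_sums f)"

lemma finite_exponents: "finite (exponents f)"
  unfolding exponents_def
  by (rule finite_subset[of _ "{..degree f}"]) (auto intro: le_degree)

lemma finite_omega_sums: "finite (omega_sums f)"
proof (rule finite_subset)
  show "omega_sums (f :: 'a poly) \<subseteq> {..card (exponents f) * (CARD('a) - 1)}"
    unfolding omega_sums_def using sum_bounded_above[of "exponents f" _ "CARD('a) - 1"] by auto
qed simp

lemma card_field_minus_1_in_omega_sums:
  fixes f :: "'a::{field,finite} poly"
  assumes "degree f > 0"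
  shows "CARD('a) - 1 \<in> omega_sums f"
proof -
  let ?g = "\<lambda>m. if m = degree f then CARD('a) - 1 else 0"
  have d: "degree f \<in> exponents f"
    using assms by (auto simp: exponents_def)
  have "(\<Sum>m\<in>exponents f. ?g m) = CARD('a) - 1"
    using d finite_exponents[of f] by (simp add: sum.delta)
  moreover have "(\<Sum>m\<in>exponents f. m * ?g m) = (CARD('a) - 1) * degree f"
    using d finite_exponents[of f] by (simp add: if_distrib sum.delta mult.commute cong: if_cong)
  ultimately show ?thesis
    unfolding omega_sums_def using assms by (intro CollectI exI[of _ ?g]) auto
qed

lemma card_field_ge_2: "CARD('a::{field,finite}) \<ge> 2"
proof -
  have "card {0, 1 :: 'a} \<le> CARD('a)" by (rule card_mono) auto
  then show ?thesis by simp
qed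

lemma omega_bounds:
  fixes f :: "'a::{field,finite} poly"
  assumes "degree f > 0"
  shows "1 \<le> omega f" and "omega f \<le> CARD('a) - 1"
proof -
  show "omega f \<le> CARD('a) - 1"
    unfolding omega_def
    by (rule Min_le[OF finite_omega_sums card_field_minus_1_in_omega_sums[OF assms]])
  have "omega f \<in> omega_sums f"
    unfolding omega_def
    using Min_in[OF finite_omega_sums] card_field_minus_1_in_omega_sums[OF assms] by blast
  then obtain g :: "nat \<Rightarrow> nat" and k where g: "omega f = (\<Sum>m\<in>exponents f. g m)" "k > 0"
      "(\<Sum>m\<in>exponents f. m * g m) = (CARD('a) - 1) * k"
    unfolding omega_sums_def by blast
  have "omega f \<noteq> 0"
  proof
    assume "omega f = 0"
    then have "\<forall>m\<in>exponents f. g m = 0" using g(1) finite_exponents[of f] by simp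
    then have "(CARD('a) - 1) * k = 0" using g(3) by simp
    then show False using g(2) card_field_ge_2[where 'a = 'a] by simp
  qed
  then show "1 \<le> omega f" by simp
qed

end

theory Submission
  imports "HOL-Algebra.Multiplicative_Group" Defs
begin

text \<open>
  As in Wan's proof of the Ax--Katz theorem, \<open>q\<^sup>r\<close> times the number of zeros is the exponential
  sum of \<open>\<psi>(\<Sum>\<^sub>j y\<^sub>j P\<^sub>j(f(x)))\<close> over \<open>x\<close> and \<open>y\<close>, the coordinates outside \<open>I\<close> being fixed. On Teichmueller
  representatives, \<open>\<psi>\<close> is a polynomial of degree \<open>q - 1\<close> whose coefficients are essentially Gauss sums;
  by Stickelberger's theorem the coefficient of \<open>T\<^sup>e\<close> is divisible by \<open>(\<xi> - 1)\<^bsup>\<sigma>(e)\<^esup>\<close>, where \<open>\<sigma>(e)\<close> is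
  the sum of the base-\<open>p\<close> digits of \<open>e\<close> and \<open>\<xi>\<close> a primitive \<open>p\<close>-th root of unity. After
  expansion into monomials, a family of exponents \<open>e\<^sub>k\<close> contributes only if the total degree in
  every variable is a multiple of \<open>q - 1\<close>. This forces the total of the \<open>e\<^sub>k\<close> to be large: a variable
  \<open>x\<^sub>i\<close> that occurs uses up at least \<open>\<omega>(f\<^sub>i)\<close> factors, and one that does not occur contributes a
  factor \<open>q\<close>. The condition is stable under cyclic rotation of the digits, and averaging over rotations
  turns the bound on \<open>\<Sum>\<^sub>k e\<^sub>k\<close> into one on \<open>\<Sum>\<^sub>k \<sigma>(e\<^sub>k)\<close>, losing nothing to rounding.
\<close>

section \<open>Lifting the finite field to characteristic zero\<close>

text \<open>Cyclicity of the unit group is available for record-based fields, so the type is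
  packaged as the record \<open>R\<close> and the generator is carried back.\<close>

lemma finite_field_generator:
  obtains g :: "'a::{field,finite}"
  where "g \<noteq> 0" "\<And>a. a \<noteq> 0 \<Longrightarrow> \<exists>k. a = g ^ k"
proof -
  define R :: "'a ring"
    where "R = \<lparr>carrier = UNIV, monoid.mult = (*), one = 1, zero = 0, add = (+)\<rparr>"
  have additive_inverse: "{y. \<exists>x. y + x = 0} = (UNIV :: 'a set)"
    by (auto intro: add.right_inverse)
  have units: "{y. \<exists>x. y * x = 1} = UNIV - {0 :: 'a}"
    by (auto intro: right_inverse)
  interpret F: field R
    by unfold_locales
      (simp_all add: R_def Units_def add.assoc mult.assoc distrib_left distrib_right,
       simp_all add: add.commute mult.commute additive_inverse units)
  have pow: "a [^]\<^bsub>R\<^esub> (k::nat) = a ^ k" for a k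
    by (induction k) (auto simp: R_def nat_pow_def)
  have car: "carrier (mult_of R) = UNIV - {0}"
    by (simp add: carrier_mult_of) (simp add: R_def)
  have "finite (carrier R)" by simp
  from F.finite_field_mult_group_has_gen[OF this]
  obtain g where g: "g \<in> carrier (mult_of R)"
      "carrier (mult_of R) = {g [^]\<^bsub>R\<^esub> i | i::nat. i \<in> UNIV}"
    by (rule bexE)
  have "\<exists>k. a = g ^ k" if "a \<noteq> 0" for a
  proof -
    have "a \<in> carrier (mult_of R)" using that unfolding car by simp
    then have "a \<in> {g [^]\<^bsub>R\<^esub> i | i::nat. i \<in> UNIV}" by (subst (asm) g(2))
    then show ?thesis by (auto simp: pow)
  qed
  moreover have "g \<noteq> 0" using g(1) unfolding car by simp
  ultimately show ?thesis using that by simp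
qed

section \<open>Integer polynomials evaluated in different rings\<close>

text \<open>One evaluation for all commutative rings, so that the same integer polynomial can be
  read at a complex number and at an element of the finite field.\<close>

definition eval_int :: "int poly \<Rightarrow> 'b::comm_ring_1 \<Rightarrow> 'b" where
  "eval_int h x = poly (map_poly of_int h) x"

lemma eval_int_pCons [simp]: "eval_int (pCons a h) x = of_int a + x * eval_int h x"
  by (simp add: eval_int_def map_poly_pCons)

lemma eval_int_0 [simp]: "eval_int 0 x = 0"
  by (simp add: eval_int_def)

lemma eval_int_1 [simp]: "eval_int 1 x = 1"
  by (simp add: one_pCons)

lemma eval_int_add [simp]: "eval_int (h + k) x = eval_int h x + eval_int k x"
proof (induction h arbitrary: k)
  case (pCons a h)
  show ?case by (cases k) (simp only: add_pCons eval_int_pCons pCons.IH, simp add: algebra_simps)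
qed simp

lemma eval_int_smult [simp]: "eval_int (smult c h) x = of_int c * eval_int h x"
  by (induction h) (auto simp: algebra_simps)

lemma eval_int_mult [simp]: "eval_int (h * k) x = eval_int h x * eval_int k x"
  by (induction h) (auto simp: algebra_simps)

lemma eval_int_power [simp]: "eval_int (h ^ n) x = eval_int h x ^ n"
  by (induction n) auto

lemma eval_int_sum [simp]: "eval_int (\<Sum>i\<in>A. h i) x = (\<Sum>i\<in>A. eval_int (h i) x)"
  by (induction A rule: infinite_finite_induct) auto

lemma eval_int_prod_mset: "eval_int (prod_mset M) x = (\<Prod>h\<in>#M. eval_int h x)"
  by (induction M) auto

lemma eval_int_uminus [simp]: "eval_int (- h) x = - eval_int h x"
  by (induction h) auto

lemma eval_int_diff [simp]: "eval_int (h - k) x = eval_int h x - eval_int k x"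
  using eval_int_add[of h "- k" x] by (simp del: eval_int_add)

text \<open>Let \<open>m\<close> have least degree among the nonzero integer polynomials vanishing
  at \<open>w\<close>. By pseudo-division, \<open>m\<close> divides each of them up to a nonzero
  constant. The prime \<open>f\<close> divides no nonzero constant, so it divides first
  \<open>m\<close> and then \<open>h\<close>.\<close>

lemma eval_int_root_dvd:
  fixes w :: "'b::{idom,ring_char_0}"
  assumes "prime_elem f" "degree f > 0" "eval_int f w = 0" "eval_int h w = 0"
  shows "f dvd h"
proof -
  have f0: "f \<noteq> 0" using assms(1) by auto
  define S where "S = {m :: int poly. m \<noteq> 0 \<and> eval_int m w = 0}"
  have fS: "f \<in> S" using assms f0 by (simp add: S_def)
  define m where "m = arg_min degree (\<lambda>m. m \<in> S)"
  have m: "m \<in> S" and min: "\<And>k. k \<in> S \<Longrightarrow> degree m \<le> degree k"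
    unfolding m_def using fS by (auto intro: arg_min_natI arg_min_nat_le)
  have degm: "degree m > 0"
  proof (rule ccontr)
    assume "\<not> degree m > 0"
    then obtain c where "m = [:c:]" by (auto elim: degree_eq_zeroE)
    with m show False by (auto simp: S_def)
  qed
  have quot: "\<exists>c k. c \<noteq> 0 \<and> [:c:] * a = m * k" if "eval_int a w = 0" for a
  proof -
    have m0: "m \<noteq> 0" using degm by auto
    obtain c k where ck: "c \<noteq> 0" "smult c a = m * k + pseudo_mod a m"
      using pseudo_mod(1)[OF m0] by blast
    have "eval_int (smult c a) w = eval_int (m * k + pseudo_mod a m) w" by (simp only: ck(2))
    then have "eval_int (pseudo_mod a m) w = 0" using that m by (simp add: S_def)
    moreover have "pseudo_mod a m = 0 \<or> degree (pseudo_mod a m) < degree m"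
      by (rule pseudo_mod(2)[OF m0])
    ultimately have "pseudo_mod a m = 0" using min[of "pseudo_mod a m"] by (fastforce simp: S_def)
    with ck show ?thesis by auto
  qed
  have const: "\<not> f dvd [:c:]" if "c \<noteq> 0" for c
    using dvd_imp_degree_le[of f "[:c:]"] that assms(2) by auto
  have "f dvd m"
  proof -
    obtain c k where ck: "c \<noteq> 0" "[:c:] * f = m * k" using quot[OF assms(3)] by blast
    have "f dvd m * k" unfolding ck(2)[symmetric] by (rule dvd_triv_right)
    then consider "f dvd m" | "f dvd k" using assms(1) by (auto simp: prime_elem_dvd_mult_iff)
    then show ?thesis
    proof cases
      \<comment> \<open>Cancelling \<open>f\<close> would make \<open>m\<close> a divisor of a
        nonzero constant, hence itself constant.\<close>
      case 2
      then obtain l where "k = f * l" by auto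
      with ck f0 have e: "[:c:] = m * l" by (simp add: algebra_simps del: mult_pCons_left mult_pCons_right)
      with ck(1) have "l \<noteq> 0" by auto
      moreover have "degree (m * l) = 0" unfolding e[symmetric] by simp
      moreover have "m \<noteq> 0" using degm by auto
      ultimately have "degree m = 0" using degree_mult_eq[of m l] by simp
      then show ?thesis using degm by simp
    qed
  qed
  moreover obtain c k where ck: "c \<noteq> 0" "[:c:] * h = m * k" using quot[OF assms(4)] by blast
  ultimately have "f dvd [:c:] * h" by simp
  then show ?thesis using const[OF ck(1)] assms(1) prime_elem_dvd_mult_iff by blast
qed

section \<open>Characteristic and unit group of a finite field\<close>

text \<open>Translation by 1 permutes the field, so comparing the sums of all elements shows that
  the field order vanishes in the field; the characteristic is thus a prime dividing
  \<open>p ^ s\<close>.\<close>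

lemma finite_field_CHAR:
  assumes "prime p" "CARD('a::{field,finite}) = p ^ s"
  shows "CHAR('a) = p"
proof -
  have "(\<Sum>x\<in>(UNIV::'a set). x + 1) = (\<Sum>x\<in>UNIV. x)"
    by (rule sum.reindex_bij_witness[of _ "\<lambda>x. x - 1" "\<lambda>x. x + 1"]) auto
  then have "(of_nat CARD('a) :: 'a) = 0" by (simp add: sum.distrib)
  then have "CHAR('a) dvd p ^ s" by (simp only: of_nat_eq_0_iff_char_dvd assms)
  moreover have "prime CHAR('a)"
    by (intro prime_CHAR_semidom finite_imp_CHAR_pos) simp
  ultimately show ?thesis
    using assms(1) by (metis prime_dvd_power primes_dvd_imp_eq)
qed

text \<open>Multiplication by \<open>x\<close> permutes the nonzero elements; compare their
  products.\<close>

lemma finite_field_power_card_minus_1: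
  fixes x :: "'a::{field,finite}"
  assumes "x \<noteq> 0"
  shows "x ^ (CARD('a) - 1) = 1"
proof -
  have "(\<Prod>y\<in>UNIV - {0}. x * y) = (\<Prod>y\<in>UNIV - {0}. y)"
    by (rule prod.reindex_bij_witness[of _ "\<lambda>y. y / x" "\<lambda>y. x * y"]) (use assms in auto)
  then have "x ^ (CARD('a) - 1) * \<Prod>(UNIV - {0}) = 1 * \<Prod>(UNIV - {0})"
    by (simp add: prod.distrib)
  moreover have "\<Prod>(UNIV - {0 :: 'a}) \<noteq> 0" by simp
  ultimately show ?thesis by (metis mult_right_cancel)
qed

text \<open>If the remainder \<open>e\<close> of \<open>d\<close> modulo \<open>n\<close> were
  positive, the powers of \<open>g\<close> would give at most \<open>e < n\<close> nonzero
  elements.\<close>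

lemma finite_field_generator_order:
  fixes g :: "'a::{field,finite}"
  assumes g: "\<And>a. a \<noteq> 0 \<Longrightarrow> \<exists>k. a = g ^ k" and d: "g ^ d = 1"
  shows "(CARD('a) - 1) dvd d"
proof (cases "g = 0")
  \<comment> \<open>The hypothesis admits \<open>g = 0\<close> when \<open>0 ^ 0 = 1\<close> is the
    only nonzero element, that is, in the field of two elements.\<close>
  case True
  have "a = 1" if "a \<noteq> 0" for a :: 'a
    using g[OF that] True that by (auto simp: power_0_left split: if_splits)
  then have "UNIV \<subseteq> {0, 1 :: 'a}" by blast
  then have "CARD('a) \<le> card {0, 1 :: 'a}" by (intro card_mono) auto
  then have "CARD('a) - 1 = 1" using card_field_ge_2[where 'a = 'a] by simp
  then show ?thesis by simp
next
  case False
  define n where "n = CARD('a) - 1"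
  have n: "n > 0" using card_field_ge_2[where 'a = 'a] by (simp add: n_def)
  have gn: "g ^ n = 1" unfolding n_def by (rule finite_field_power_card_minus_1[OF False])
  define e where "e = d mod n"
  have "g ^ d = (g ^ n) ^ (d div n) * g ^ e"
    unfolding e_def power_mult[symmetric] power_add[symmetric] by simp
  then have e: "g ^ e = 1" using gn d by simp
  have "e = 0"
  proof (rule ccontr)
    assume "e \<noteq> 0"
    have "UNIV - {0} \<subseteq> (\<lambda>k. g ^ k) ` {..<e}"
    proof
      fix a :: 'a assume "a \<in> UNIV - {0}"
      then obtain k where k: "a = g ^ k" using g by auto
      have "g ^ k = (g ^ e) ^ (k div e) * g ^ (k mod e)"
        unfolding power_mult[symmetric] power_add[symmetric] by simp
      then have "a = g ^ (k mod e)" using e k by simp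
      moreover have "k mod e < e" using \<open>e \<noteq> 0\<close> by simp
      ultimately show "a \<in> (\<lambda>k. g ^ k) ` {..<e}" by blast
    qed
    then have "card (UNIV - {0 :: 'a}) \<le> card ((\<lambda>k. g ^ k) ` {..<e})" by (intro card_mono) auto
    also have "\<dots> \<le> e" using card_image_le[of "{..<e}"] by simp
    also have "e < n" using n by (simp add: e_def)
    finally show False by (simp add: n_def)
  qed
  then show ?thesis by (simp add: e_def n_def dvd_eq_mod_eq_0)
qed

text \<open>A complex substitute for a \<open>p\<close>-adic ring of integers: a subring
  \<open>A\<close> with a residue map \<open>red\<close> onto the finite field, a multiplicative
  section \<open>T\<close> of it, and a nontrivial \<open>p\<close>-th root of unity reducing to 1.
  Nothing is assumed about \<open>red\<close> outside \<open>A\<close>.\<close>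

locale teichmueller =
  fixes p s :: nat and A :: "complex set" and red :: "complex \<Rightarrow> 'a::{field,finite}"
    and T :: "'a \<Rightarrow> complex" and xi :: complex
  assumes prime_p: "prime p" and card_field: "CARD('a) = p ^ s"
    and one_closed [simp]: "1 \<in> A"
    and diff_closed [simp]: "a \<in> A \<Longrightarrow> b \<in> A \<Longrightarrow> a - b \<in> A"
    and mult_closed [simp]: "a \<in> A \<Longrightarrow> b \<in> A \<Longrightarrow> a * b \<in> A"
    and red_1 [simp]: "red 1 = 1"
    and red_diff [simp]: "a \<in> A \<Longrightarrow> b \<in> A \<Longrightarrow> red (a - b) = red a - red b"
    and red_mult [simp]: "a \<in> A \<Longrightarrow> b \<in> A \<Longrightarrow> red (a * b) = red a * red b"
    and T_closed [simp]: "T x \<in> A"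
    and T_0 [simp]: "T 0 = 0"
    and T_mult: "T (x * y) = T x * T y"
    and red_T [simp]: "red (T x) = x"
    and xi_closed [simp]: "xi \<in> A"
    and xi_power: "xi ^ p = 1"
    and xi_neq_1: "xi \<noteq> 1"
    and red_xi [simp]: "red xi = 1"

lemma eval_int_monom: "eval_int (monom c k) x = of_int c * x ^ k"
  by (simp add: monom_altdef)

lemma eval_int_X_power: "eval_int ([:0, 1:] ^ k) x = x ^ k"
  by simp

lemma eval_int_geometric: "eval_int (\<Sum>i<m. monom 1 (n * i)) x = (\<Sum>i<m. (x ^ n) ^ i)"
  by (simp add: eval_int_monom power_mult)

text \<open>The ring is \<open>\<int>[w]\<close> for a complex root \<open>w\<close> of a prime factor of
  \<open>(X\<^bsup>p(q-1)\<^esup> - 1) / (X\<^bsup>q-1\<^esup> - 1)\<close> that vanishes at a generator \<open>g\<close> of the multiplicative group: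
  primality makes \<open>h(w) \<mapsto> h(g)\<close> well defined without knowing that cyclotomic
  polynomials are irreducible.\<close>

theorem teichmueller_exists:
  assumes p: "prime p" and card: "CARD('a::{field,finite}) = p ^ s"
  obtains A and red :: "complex \<Rightarrow> 'a::{field,finite}" and T xi where "teichmueller p s A red T xi"
proof -
  obtain g :: 'a where g0: "g \<noteq> 0" and gen: "\<And>a. a \<noteq> 0 \<Longrightarrow> \<exists>k. a = g ^ k"
    using finite_field_generator by blast
  define q where "q = p ^ s"
  define n where "n = q - 1"
  have q2: "q \<ge> 2" using card_field_ge_2[where 'a = 'a] by (simp add: card q_def)
  have n0: "n > 0" using q2 by (simp add: n_def)
  have s0: "s > 0" using q2 by (cases s) (auto simp: q_def)
  have gn: "g ^ n = 1" using finite_field_power_card_minus_1[OF g0] by (simp add: n_def q_def card)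
  have char: "(of_nat p :: 'a) = 0"
    using finite_field_CHAR[OF p card] of_nat_CHAR by metis
  define Q :: "int poly" where "Q = (\<Sum>i<p. monom 1 (n * i))"
  note evQ = eval_int_geometric[of n p, folded Q_def]
  \<comment> \<open>Constant term 1 forces every constant divisor of \<open>Q\<close> to be a unit,
    so the prime factor \<open>f\<close> chosen below is nonconstant.\<close>
  have Q_one: "poly Q 0 = 1"
  proof -
    have "poly Q 0 = (\<Sum>i<p. (0::int) ^ (n * i))" by (simp add: Q_def poly_sum poly_monom)
    also have "\<dots> = (\<Sum>i<p. if i = 0 then 1 else 0)"
      using n0 by (intro sum.cong) (auto simp: power_0_left)
    also have "\<dots> = 1" using prime_gt_0_nat[OF p] by (simp add: sum.delta)
    finally show ?thesis .
  qed
  then have Q0: "Q \<noteq> 0" by auto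
  obtain M where M: "\<And>h. h \<in># M \<Longrightarrow> prime_elem h" "normalize (prod_mset M) = normalize Q"
    using prime_factorization_exists[OF Q0] by blast
  have MQ: "Q dvd prod_mset M" "prod_mset M dvd Q" using M(2) by (auto dest: associatedD1 associatedD2)
  have "eval_int (prod_mset M) g = 0"
  proof -
    obtain k where "prod_mset M = Q * k" using MQ(1) by auto
    then show ?thesis by (simp add: evQ gn char)
  qed
  then obtain f where f: "f \<in># M" "eval_int f g = 0"
    by (auto simp: eval_int_prod_mset)
  have f_prime: "prime_elem f" by (rule M(1)[OF f(1)])
  have fQ: "f dvd Q" using dvd_prod_mset[OF f(1)] MQ(2) by (rule dvd_trans)
  have f_deg: "degree f > 0"
  proof (rule ccontr)
    assume "\<not> degree f > 0"
    then obtain c where c: "f = [:c:]" by (auto elim: degree_eq_zeroE)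
    obtain k where "Q = [:c:] * k" using fQ c by auto
    then have "1 = c * poly k 0" using Q_one by simp
    then have "c dvd 1" by (rule dvdI)
    then have "is_unit f" unfolding c by (simp only: is_unit_const_poly_iff)
    then show False using f_prime by (auto simp: prime_elem_def)
  qed
  have "\<not> constant (poly (map_poly of_int f :: complex poly))"
    using f_deg by (simp add: constant_degree degree_map_poly)
  then obtain w :: complex where w: "eval_int f w = 0"
    using fundamental_theorem_of_algebra unfolding eval_int_def by blast
  have wQ: "(\<Sum>i<p. (w ^ n) ^ i) = 0"
  proof -
    obtain k where "Q = f * k" using fQ by auto
    then have "eval_int Q w = 0" using w by simp
    then show ?thesis by (simp add: evQ)
  qed
  have xi1: "w ^ n \<noteq> 1"
  proof
    assume "w ^ n = 1"
    then have "(of_nat p :: complex) = 0" using wQ by simp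
    then show False using prime_gt_0_nat[OF p] by simp
  qed
  have xip: "(w ^ n) ^ p = 1"
    using power_diff_1_eq[of "w ^ n" p] wQ by simp
  have kernel: "eval_int h g = eval_int k g" if "eval_int h w = eval_int k w" for h k
  proof -
    have "eval_int (h - k) w = 0" using that by simp
    then obtain l where l: "h - k = f * l"
      using eval_int_root_dvd[OF f_prime f_deg w] by blast
    have "eval_int (h - k) g = 0" unfolding l using f(2) by simp
    then show ?thesis by simp
  qed
  define A where "A = range (\<lambda>h. eval_int h w)"
  define red :: "complex \<Rightarrow> 'a" where "red a = eval_int (SOME h. eval_int h w = a) g" for a
  have red: "red (eval_int h w) = eval_int h g" for h
    unfolding red_def by (rule kernel) (metis (mono_tags, lifting) someI)
  have A: "eval_int h w \<in> A" for h by (simp add: A_def)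
  \<comment> \<open>The exponent \<open>q\<close> removes the \<open>p\<close>-part of the order of
    \<open>w\<close>: the order of \<open>w ^ q\<close> divides \<open>n\<close>, so
    \<open>T\<close> respects the relations between powers of \<open>g\<close>, while
    \<open>g ^ q = g\<close> keeps \<open>red (T x) = x\<close>.\<close>
  define T where "T x = (if x = 0 then 0 else w ^ (q * (SOME k. x = g ^ k)))" for x
  have wq: "w ^ (q * n) = 1"
  proof -
    have "q * n = n * p * p ^ (s - 1)" using s0 by (cases s) (auto simp: q_def)
    then have "w ^ (q * n) = ((w ^ n) ^ p) ^ (p ^ (s - 1))" by (simp only: power_mult)
    then show ?thesis using xip by simp
  qed
  have le: "w ^ (q * k) = w ^ (q * l)" if gkl: "g ^ k = g ^ l" and kl: "k \<le> l" for k l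
  proof -
    have "g ^ k * g ^ (l - k) = g ^ l" using kl by (simp flip: power_add)
    then have "g ^ k * g ^ (l - k) = g ^ k * 1" using gkl by simp
    then have "g ^ (l - k) = 1" using g0 by simp
    then have "n dvd l - k"
      using finite_field_generator_order[OF gen] by (simp add: n_def q_def card)
    then obtain j where "l = k + n * j" using kl by (metis dvdE le_add_diff_inverse)
    then have "w ^ (q * l) = w ^ (q * k) * (w ^ (q * n)) ^ j"
      unfolding power_mult[symmetric] power_add[symmetric] by (simp add: distrib_left mult.assoc)
    then show ?thesis using wq by simp
  qed
  have Tg: "T (g ^ k) = w ^ (q * k)" for k
  proof -
    define l where "l = (SOME l. g ^ k = g ^ l)"
    have "g ^ k = g ^ l" unfolding l_def by (rule someI[of _ k]) simp
    then have "w ^ (q * k) = w ^ (q * l)" using le[of k l] le[of l k] linear[of k l] by metis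
    then show ?thesis using g0 by (simp add: T_def l_def)
  qed
  have gq: "g ^ q = g"
  proof -
    have "q = Suc n" using q2 by (simp add: n_def)
    then show ?thesis using gn by simp
  qed
  have T_red: "T x \<in> A \<and> red (T x) = x" for x
  proof (cases "x = 0")
    case True
    then show ?thesis using A[of 0] red[of 0] by (simp add: T_def)
  next
    case False
    then obtain k where k: "x = g ^ k" using gen by blast
    have "T x = eval_int ([:0, 1:] ^ (q * k)) w" unfolding k Tg eval_int_X_power ..
    moreover have "eval_int ([:0, 1:] ^ (q * k)) g = x"
      unfolding eval_int_X_power by (simp add: k power_mult gq)
    ultimately show ?thesis using A red by metis
  qed
  have "teichmueller p s A red T (w ^ n)"
  proof
    show "1 \<in> A" "red 1 = 1" using A[of 1] red[of 1] by simp_all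
    fix a b assume "a \<in> A" "b \<in> A"
    then obtain h k where hk: "a = eval_int h w" "b = eval_int k w" by (auto simp: A_def)
    have m: "a - b = eval_int (h - k) w" "a * b = eval_int (h * k) w" by (simp_all add: hk)
    show "a - b \<in> A" "a * b \<in> A" unfolding m by (rule A)+
    show "red (a - b) = red a - red b" "red (a * b) = red a * red b"
      unfolding m red by (simp_all add: hk red)
  next
    show "w ^ n \<in> A" "red (w ^ n) = 1"
      using A[of "[:0, 1:] ^ n"] red[of "[:0, 1:] ^ n"] gn by simp_all
  next
    fix x y :: 'a
    show "T (x * y) = T x * T y"
    proof (cases "x = 0 \<or> y = 0")
      case False
      then obtain k l where kl: "x = g ^ k" "y = g ^ l" using gen by blast
      have "x * y = g ^ (k + l)" by (simp add: kl power_add)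
      then have "T (x * y) = w ^ (q * (k + l))" by (simp only: Tg)
      also have "\<dots> = T x * T y" unfolding kl Tg by (simp add: algebra_simps power_add)
      finally show ?thesis .
    qed (auto simp: T_def)
  qed (use p card T_red xip xi1 in \<open>auto simp: T_def\<close>)
  then show ?thesis by (rule that)
qed

section \<open>The additive character\<close>

context teichmueller
begin

section \<open>Arithmetic of the residue map and of Teichmueller representatives\<close>

definition q :: nat where "q = p ^ s"

lemma card_q: "CARD('a) = q"
  by (simp add: q_def card_field)

lemma q_ge_2: "q \<ge> 2"
  using card_field_ge_2[where 'a = 'a] by (simp add: card_q)

lemma s_pos: "s > 0"
  using q_ge_2 unfolding q_def by (cases s) auto

lemma p_ge_2: "p \<ge> 2"
  using prime_ge_2_nat[OF prime_p] .

lemma char_p: "CHAR('a) = p"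
  by (rule finite_field_CHAR[OF prime_p card_field])

lemma of_nat_field_eq_0_iff: "(of_nat n :: 'a) = 0 \<longleftrightarrow> p dvd n"
  by (simp add: of_nat_eq_0_iff_char_dvd char_p)

lemma of_nat_q: "(of_nat q :: 'a) = 0"
  using s_pos by (simp add: of_nat_field_eq_0_iff q_def)

lemma power_q: "(x :: 'a) ^ q = x"
proof (cases "x = 0")
  case False
  have "x ^ q = x * x ^ (q - 1)" using q_ge_2 by (cases q) auto
  then show ?thesis using finite_field_power_card_minus_1[OF False] by (simp add: card_q)
qed (use q_ge_2 in auto)

lemma zero_closed [simp]: "0 \<in> A"
  using diff_closed[OF one_closed one_closed] by simp

lemma red_0 [simp]: "red 0 = 0"
  using red_diff[OF one_closed one_closed] by simp

lemma uminus_closed [simp]: "a \<in> A \<Longrightarrow> - a \<in> A"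
  using diff_closed[OF zero_closed, of a] by simp

lemma red_uminus [simp]: "a \<in> A \<Longrightarrow> red (- a) = - red a"
  using red_diff[OF zero_closed, of a] by simp

lemma add_closed [simp]: "a \<in> A \<Longrightarrow> b \<in> A \<Longrightarrow> a + b \<in> A"
  using diff_closed[of a "- b"] by simp

lemma red_add [simp]: "a \<in> A \<Longrightarrow> b \<in> A \<Longrightarrow> red (a + b) = red a + red b"
  using red_diff[of a "- b"] by simp

lemma power_closed [simp]: "a \<in> A \<Longrightarrow> a ^ k \<in> A"
  by (induction k) auto

lemma red_power [simp]: "a \<in> A \<Longrightarrow> red (a ^ k) = red a ^ k"
  by (induction k) auto

lemma of_nat_closed [simp]: "of_nat k \<in> A"
  by (induction k) auto

lemma red_of_nat [simp]: "red (of_nat k) = of_nat k"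
  by (induction k) auto

lemma sum_closed: "(\<And>x. x \<in> B \<Longrightarrow> f x \<in> A) \<Longrightarrow> sum f B \<in> A"
  by (induction B rule: infinite_finite_induct) auto

lemma red_sum: "(\<And>x. x \<in> B \<Longrightarrow> f x \<in> A) \<Longrightarrow> red (sum f B) = (\<Sum>x\<in>B. red (f x))"
  by (induction B rule: infinite_finite_induct) (auto simp: sum_closed)

lemma T_eq_iff: "T x = T y \<longleftrightarrow> x = y"
  by (metis red_T)

lemma T_1 [simp]: "T 1 = 1"
proof -
  have "T 1 * T 1 = T 1" by (simp flip: T_mult)
  moreover have "T 1 \<noteq> 0" using T_eq_iff[of 1 0] by simp
  ultimately show ?thesis by simp
qed

lemma T_power: "T (x ^ k) = T x ^ k"
  by (induction k) (auto simp: T_mult)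

lemma T_prod: "T (\<Prod>x\<in>B. f x) = (\<Prod>x\<in>B. T (f x))"
  by (induction B rule: infinite_finite_induct) (auto simp: T_mult)

lemma T_power_q_minus_1: "x \<noteq> 0 \<Longrightarrow> T x ^ (q - 1) = 1"
  using finite_field_power_card_minus_1[of x] by (simp flip: T_power add: card_q)

text \<open>If \<open>q - 1\<close> does not divide \<open>k\<close>, substituting
  \<open>g * x\<close> for \<open>x\<close> multiplies the sum by \<open>T g ^ k\<close>, which is
  not 1. The term at 0 counts only for \<open>k = 0\<close>, which separates \<open>q\<close> from
  \<open>q - 1\<close>; this is where an absent variable gains its factor \<open>q\<close>.\<close>

lemma sum_T_power:
  "(\<Sum>x\<in>UNIV. T x ^ k) =
     (if k = 0 then of_nat q else if (q - 1) dvd k then of_nat (q - 1) else 0)"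
proof (cases "k = 0")
  case False
  have nz: "(\<Sum>x\<in>UNIV. T x ^ k) = (\<Sum>x\<in>UNIV - {0}. T x ^ k)"
    using False by (intro sum.mono_neutral_right) auto
  show ?thesis
  proof (cases "(q - 1) dvd k")
    case True
    then obtain l where "k = (q - 1) * l" by auto
    then have "(\<Sum>x\<in>UNIV - {0}. T x ^ k) = (\<Sum>x\<in>UNIV - {0::'a}. 1)"
      by (intro sum.cong) (auto simp: power_mult T_power_q_minus_1 simp del: One_nat_def)
    with nz True False show ?thesis by (simp add: card_q)
  next
    case ndvd: False
    obtain g :: 'a where g: "g \<noteq> 0" "\<And>a. a \<noteq> 0 \<Longrightarrow> \<exists>k. a = g ^ k"
      using finite_field_generator by blast
    have "g ^ k \<noteq> 1" using finite_field_generator_order[OF g(2), of k] ndvd by (auto simp: card_q)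
    then have g1: "T g ^ k \<noteq> 1" using T_eq_iff[of "g ^ k" 1] by (simp add: T_power)
    have "(\<Sum>x\<in>UNIV. T x ^ k) = (\<Sum>x\<in>UNIV. T (g * x) ^ k)"
      by (rule sum.reindex_bij_witness[of _ "\<lambda>x. g * x" "\<lambda>x. x / g"]) (use g(1) in auto)
    also have "\<dots> = T g ^ k * (\<Sum>x\<in>UNIV. T x ^ k)"
      by (simp add: T_mult power_mult_distrib sum_distrib_left)
    finally show ?thesis using g1 False ndvd by simp
  qed
qed (simp add: card_q)

lemma sum_T_inverse_power: "(\<Sum>x\<in>UNIV. T (inverse x) ^ k) = (\<Sum>x\<in>UNIV. T x ^ k)"
  by (rule sum.reindex_bij_witness[of _ inverse inverse]) auto

section \<open>The trace and the canonical additive character\<close>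

definition trace :: "'a \<Rightarrow> 'a" where "trace x = (\<Sum>i<s. x ^ (p ^ i))"

lemma trace_add: "trace (x + y) = trace x + trace y"
  unfolding trace_def sum.distrib[symmetric]
  by (intro sum.cong refl freshmans_dream') (simp_all add: char_p prime_p)

text \<open>Since \<open>x ^ q = x\<close>, raising to the power \<open>p\<close> permutes the
  conjugates cyclically.\<close>

lemma sum_frobenius_shift: "(\<Sum>i<s. (x :: 'a) ^ (p ^ Suc i)) = trace x"
proof -
  have "(\<Sum>i<s. x ^ (p ^ Suc i)) + x = (\<Sum>i<Suc s. x ^ (p ^ i))"
    by (subst sum.lessThan_Suc_shift) (simp add: add.commute)
  also have "\<dots> = trace x + x" by (simp add: trace_def power_q[unfolded q_def])
  finally show ?thesis by simp
qed

lemma trace_frobenius: "trace (x ^ p) = trace x"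
  using sum_frobenius_shift[of x] by (simp add: trace_def flip: power_mult)

lemma trace_power_p: "trace x ^ p = trace x"
proof -
  have "trace x ^ p = (\<Sum>i<s. (x ^ (p ^ i)) ^ p)"
    unfolding trace_def by (intro freshmans_dream_sum) (simp_all add: char_p prime_p)
  also have "\<dots> = trace x"
    using sum_frobenius_shift[of x] by (simp add: mult.commute flip: power_mult)
  finally show ?thesis .
qed

lemma xi_power_cong:
  assumes "(of_nat k :: 'a) = of_nat l" shows "xi ^ k = xi ^ l"
proof -
  have *: "xi ^ k = xi ^ l" if eq: "(of_nat k :: 'a) = of_nat l" and kl: "k \<le> l" for k l
  proof -
    have "(of_nat (l - k) :: 'a) = 0" using eq kl by (simp add: of_nat_diff)
    then have "p dvd l - k" by (simp only: of_nat_field_eq_0_iff)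
    then obtain j where "l - k = p * j" by (rule dvdE)
    then have "l = k + p * j" using kl by simp
    then show ?thesis by (simp add: power_add power_mult xi_power)
  qed
  show ?thesis using *[of k l] *[of l k] assms linear[of k l] by metis
qed

text \<open>The images of \<open>0, ..., p - 1\<close> are already \<open>p\<close> distinct roots
  of \<open>X ^ p - X\<close>, which has no more.\<close>

lemma prime_field_of_nat:
  assumes "(x :: 'a) ^ p = x" shows "\<exists>k. x = of_nat k"
proof -
  define P :: "'a poly" where "P = monom 1 p - monom 1 1"
  have "coeff P p = 1" using p_ge_2 by (simp add: P_def)
  then have P0: "P \<noteq> 0" by auto
  have deg: "degree P \<le> p" unfolding P_def
    using p_ge_2 by (intro degree_diff_le) (auto simp: degree_monom_eq)
  have roots: "poly P x = 0 \<longleftrightarrow> x ^ p = x" for x by (simp add: P_def poly_monom)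
  have inj: "inj_on (of_nat :: nat \<Rightarrow> 'a) {..<p}"
  proof (rule linorder_inj_onI)
    fix k l assume kl: "k < l" "k \<in> {..<p}" "l \<in> {..<p}"
    show "(of_nat k :: 'a) \<noteq> of_nat l"
    proof
      assume "(of_nat k :: 'a) = of_nat l"
      then have "(of_nat (l - k) :: 'a) = 0" using kl by (simp add: of_nat_diff)
      then have "p dvd l - k" by (simp only: of_nat_field_eq_0_iff)
      then show False using kl by (auto dest: dvd_imp_le)
    qed
  qed auto
  have fermat: "(of_nat k :: 'a) ^ p = of_nat k" for k
  proof (induction k)
    case (Suc k)
    have "(1 + of_nat k :: 'a) ^ p = 1 ^ p + of_nat k ^ p"
      by (intro freshmans_dream) (simp_all add: char_p prime_p)
    with Suc show ?case by simp
  qed (use p_ge_2 in auto)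
  have "of_nat ` {..<p} = {x. poly P x = 0}"
  proof (rule card_subset_eq)
    show "finite {x. poly P x = 0}" by simp
    show sub: "of_nat ` {..<p} \<subseteq> {x. poly P x = 0}" using fermat by (auto simp: roots)
    have "card {x. poly P x = 0} \<le> p" using card_poly_roots_bound[OF P0] deg by simp
    moreover have "card (of_nat ` {..<p} :: 'a set) = p" using card_image[OF inj] by simp
    moreover have "card (of_nat ` {..<p} :: 'a set) \<le> card {x. poly P x = 0}"
      using sub by (intro card_mono) auto
    ultimately show "card (of_nat ` {..<p} :: 'a set) = card {x. poly P x = 0}" by simp
  qed
  moreover have "x \<in> {x. poly P x = 0}" using assms by (simp add: roots)
  ultimately show ?thesis by blast
qed

text \<open>The trace is given by a nonzero polynomial of degree at most \<open>p ^ (s - 1)\<close>,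
  which has too few roots to vanish on all \<open>q\<close> elements.\<close>

lemma trace_nonzero: "\<exists>x. trace x \<noteq> 0"
proof (rule ccontr)
  assume "\<nexists>x. trace x \<noteq> 0"
  then have tr0: "trace x = 0" for x by blast
  define P :: "'a poly" where "P = (\<Sum>i<s. monom 1 (p ^ i))"
  have "coeff P 1 = (\<Sum>i<s. if i = 0 then 1 else 0)"
    unfolding P_def coeff_sum using p_ge_2 by (intro sum.cong) (auto simp: coeff_monom)
  also have "\<dots> = 1" using s_pos by (simp add: sum.delta)
  finally have P0: "P \<noteq> 0" by auto
  have deg: "degree P \<le> p ^ (s - 1)" unfolding P_def
    by (intro degree_sum_le) (use p_ge_2 in \<open>auto simp: degree_monom_eq intro!: power_increasing\<close>)
  have "{x. poly P x = 0} = UNIV" using tr0 by (auto simp: P_def poly_sum poly_monom trace_def)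
  then have "q \<le> p ^ (s - 1)" using card_poly_roots_bound[OF P0] deg by (simp add: card_q)
  also have "\<dots> < q" unfolding q_def using p_ge_2 s_pos by (intro power_strict_increasing) auto
  finally show False by simp
qed

text \<open>The trace lies in the prime field; any natural number representing it may serve as
  exponent, because \<open>xi ^ p = 1\<close>.\<close>

definition psi :: "'a \<Rightarrow> complex" where "psi x = xi ^ (SOME k. of_nat k = trace x)"

lemma psi_eq: assumes "of_nat k = trace x" shows "psi x = xi ^ k"
proof -
  have "of_nat (SOME k. of_nat k = trace x) = trace x" using assms by (rule someI)
  then show ?thesis unfolding psi_def using assms by (intro xi_power_cong) simp
qed

lemma psiE: obtains k where "of_nat k = trace x" "psi x = xi ^ k"
  using prime_field_of_nat[OF trace_power_p] psi_eq by metis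

lemma psi_add: "psi (x + y) = psi x * psi y"
proof -
  obtain k where k: "of_nat k = trace x" "psi x = xi ^ k" by (rule psiE)
  obtain l where l: "of_nat l = trace y" "psi y = xi ^ l" by (rule psiE)
  have "psi (x + y) = xi ^ (k + l)" by (rule psi_eq) (simp add: trace_add k l)
  then show ?thesis by (simp add: k l power_add)
qed

lemma psi_0 [simp]: "psi 0 = 1"
proof -
  have "trace 0 = 0" using p_ge_2 by (simp add: trace_def power_0_left)
  then show ?thesis using psi_eq[of 0 0] by simp
qed

lemma psi_sum: "psi (\<Sum>x\<in>B. f x) = (\<Prod>x\<in>B. psi (f x))"
  by (induction B rule: infinite_finite_induct) (auto simp: psi_add)

lemma psi_frobenius: "psi (x ^ p) = psi x"
  by (simp add: psi_def trace_frobenius)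

lemma psi_closed [simp]: "psi x \<in> A"
  by (simp add: psi_def)

text \<open>A geometric series. The factor \<open>xi - 1\<close> gained here starts the induction
  for Gauss sums.\<close>

lemma psi_minus_1: "\<exists>v\<in>A. psi x - 1 = (xi - 1) * v"
proof -
  define k where "k = (SOME k. of_nat k = trace x)"
  have "psi x - 1 = (xi - 1) * (\<Sum>i<k. xi ^ i)" by (simp add: psi_def k_def power_diff_1_eq)
  then show ?thesis by (blast intro: sum_closed power_closed xi_closed)
qed

lemma psi_nontrivial: "\<exists>x. psi x \<noteq> 1"
proof -
  obtain x where x: "trace x \<noteq> 0" using trace_nonzero by blast
  obtain k where k: "of_nat k = trace x" "psi x = xi ^ k" by (rule psiE)
  have pk: "\<not> p dvd k" using k x of_nat_field_eq_0_iff by metis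
  then have "coprime k p" using prime_p by (metis coprime_commute prime_imp_coprime)
  moreover have "k \<noteq> 0" using pk by (cases k) auto
  \<comment> \<open>Were \<open>xi ^ k\<close> equal to 1, its \<open>a\<close>-th power would give
    \<open>xi = 1\<close>.\<close>
  ultimately obtain a b where "k * a = p * b + 1" using bezout_nat[of k p] by auto
  then have "(xi ^ k) ^ a = (xi ^ p) ^ b * xi" by (simp flip: power_mult)
  then have "xi ^ k \<noteq> 1" using xi_neq_1 by (auto simp: xi_power)
  then have "psi x \<noteq> 1" by (simp only: k(2) not_False_eq_True)
  then show ?thesis ..
qed

text \<open>For \<open>z\<close> nonzero, shifting \<open>y\<close> by \<open>x / z\<close>
  multiplies the sum by \<open>psi x\<close>, and some \<open>psi x\<close> differs from 1.\<close>

lemma sum_psi_mult: "(\<Sum>y\<in>UNIV. psi (y * z)) = (if z = 0 then of_nat q else 0)"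
proof (cases "z = 0")
  case False
  obtain x where x: "psi x \<noteq> 1" using psi_nontrivial by blast
  have "(\<Sum>y\<in>UNIV. psi (y * z)) = (\<Sum>y\<in>UNIV. psi (y * z + x))"
    by (rule sum.reindex_bij_witness[of _ "\<lambda>y. y + x / z" "\<lambda>y. y - x / z"])
       (use False in \<open>auto simp: algebra_simps\<close>)
  also have "\<dots> = psi x * (\<Sum>y\<in>UNIV. psi (y * z))"
    by (simp add: psi_add sum_distrib_left mult.commute)
  finally show ?thesis using x False by simp
qed (simp add: card_q)

end

section \<open>Gauss sums\<close>

context teichmueller
begin

section \<open>Divisibility by powers of the uniformizer\<close>

text \<open>Expand \<open>1 = (z + 1) ^ p\<close> with \<open>z = xi - 1\<close>. The middle
  binomial coefficients are divisible by \<open>p\<close>, so dividing by \<open>z\<close> leaves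
  \<open>z ^ (p - 1) = - p * u\<close>; modulo the kernel of \<open>red\<close> only the linear term
  contributes to \<open>u\<close>, giving \<open>red u = 1\<close>.\<close>

lemma p_associated_power:
  obtains w where "w \<in> A" "red w \<noteq> 0" "(xi - 1) ^ (p - 1) = of_nat p * w"
proof -
  define z where "z = xi - 1"
  have z: "z \<in> A" "red z = 0" "z \<noteq> 0" using xi_neq_1 by (simp_all add: z_def)
  define c where "c k = (p choose k) div p" for k
  have c: "p choose k = p * c k" if "k \<in> {1..p - 1}" for k
    unfolding c_def using that prime_p
    by (intro dvd_mult_div_cancel[symmetric] dvd_choose_prime) auto
  define u where "u = (\<Sum>k=1..p - 1. of_nat (c k) * z ^ (k - 1))"
  have uA: "u \<in> A" unfolding u_def by (intro sum_closed) (simp add: z)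
  have "red u = (\<Sum>k=1..p - 1. of_nat (c k) * 0 ^ (k - 1))"
    unfolding u_def by (subst red_sum) (simp_all add: z)
  also have "\<dots> = (\<Sum>k=1..p - 1. if k = 1 then 1 else 0)"
    using p_ge_2 by (intro sum.cong) (auto simp: power_0_left c_def)
  also have "\<dots> = 1" using p_ge_2 by (simp add: sum.delta)
  finally have ru: "red u = 1" .
  have "1 = (z + 1) ^ p" by (simp add: z_def xi_power)
  also have "\<dots> = (\<Sum>k\<le>p. of_nat (p choose k) * z ^ k)" by (simp add: binomial_ring)
  also have "{..p} = insert 0 (insert p {1..p - 1})" using p_ge_2 by auto
  also have "(\<Sum>k\<in>\<dots>. of_nat (p choose k) * z ^ k)
      = 1 + (z ^ p + (\<Sum>k=1..p - 1. of_nat (p choose k) * z ^ k))"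
    using p_ge_2 by (subst sum.insert, simp, force, subst sum.insert, simp, force) simp
  also have "(\<Sum>k=1..p - 1. of_nat (p choose k) * z ^ k)
      = (\<Sum>k=1..p - 1. of_nat p * z * (of_nat (c k) * z ^ (k - 1)))"
  proof (rule sum.cong)
    fix k assume k: "k \<in> {1..p - 1}"
    have "z ^ k = z * z ^ (k - 1)" using k by (cases k) auto
    then show "of_nat (p choose k) * z ^ k = of_nat p * z * (of_nat (c k) * z ^ (k - 1))"
      using c[OF k] by simp
  qed simp
  also have "\<dots> = of_nat p * z * u" by (simp add: u_def sum_distrib_left)
  finally have "z ^ p + of_nat p * z * u = 0" by simp
  moreover have "z ^ p = z * z ^ (p - 1)" using p_ge_2 by (cases p) auto
  ultimately have "z * (z ^ (p - 1) + of_nat p * u) = 0" by (simp add: algebra_simps)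
  then have "z ^ (p - 1) = of_nat p * (- u)" using z(3) by (simp add: eq_neg_iff_add_eq_0)
  moreover have "- u \<in> A" "red (- u) \<noteq> 0" using uA ru by simp_all
  ultimately show ?thesis using that unfolding z_def by blast
qed

text \<open>Divisibility by a power of the uniformizer \<open>xi - 1\<close> in the localization of \<open>A\<close> at the kernel
  of \<open>red\<close>; clearing denominators avoids constructing the localization.\<close>

definition ordge :: "nat \<Rightarrow> complex \<Rightarrow> bool" where
  "ordge k a \<longleftrightarrow> a \<in> A \<and> (\<exists>u\<in>A. red u \<noteq> 0 \<and> (\<exists>v\<in>A. u * a = (xi - 1) ^ k * v))"

lemma ordgeI:
  "a \<in> A \<Longrightarrow> u \<in> A \<Longrightarrow> red u \<noteq> 0 \<Longrightarrow> v \<in> A \<Longrightarrow> u * a = (xi - 1) ^ k * v \<Longrightarrow> ordge k a"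
  unfolding ordge_def by blast

lemma ordge_0: "a \<in> A \<Longrightarrow> ordge 0 a"
  by (rule ordgeI[of _ 1 a]) simp_all

lemma ordge_zero: "ordge k 0"
  by (rule ordgeI[of _ 1 0]) simp_all

lemma ordge_uniformizer: "v \<in> A \<Longrightarrow> ordge k ((xi - 1) ^ k * v)"
  by (rule ordgeI[of _ 1 v]) simp_all

lemma ordge_mult: assumes "ordge k a" "ordge l b" shows "ordge (k + l) (a * b)"
proof -
  obtain u v where 1: "a \<in> A" "u \<in> A" "red u \<noteq> 0" "v \<in> A" "u * a = (xi - 1) ^ k * v"
    using assms(1) unfolding ordge_def by blast
  obtain u' v' where 2: "b \<in> A" "u' \<in> A" "red u' \<noteq> 0" "v' \<in> A" "u' * b = (xi - 1) ^ l * v'"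
    using assms(2) unfolding ordge_def by blast
  have "u * u' * (a * b) = (u * a) * (u' * b)" by simp
  also have "\<dots> = (xi - 1) ^ (k + l) * (v * v')" unfolding 1(5) 2(5) by (simp add: power_add)
  finally show ?thesis using 1 2 by (intro ordgeI[of _ "u * u'" "v * v'"]) auto
qed

lemma ordge_mono: assumes "ordge k a" "l \<le> k" shows "ordge l a"
proof -
  obtain u v where 1: "a \<in> A" "u \<in> A" "red u \<noteq> 0" "v \<in> A" "u * a = (xi - 1) ^ k * v"
    using assms(1) unfolding ordge_def by blast
  have "(xi - 1) ^ k = (xi - 1) ^ l * (xi - 1) ^ (k - l)" using assms(2) by (simp flip: power_add)
  then show ?thesis using 1 by (intro ordgeI[of _ u "(xi - 1) ^ (k - l) * v"]) auto
qed

lemma ordge_add: assumes "ordge k a" "ordge k b" shows "ordge k (a + b)"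
proof -
  obtain u v where 1: "a \<in> A" "u \<in> A" "red u \<noteq> 0" "v \<in> A" "u * a = (xi - 1) ^ k * v"
    using assms(1) unfolding ordge_def by blast
  obtain u' v' where 2: "b \<in> A" "u' \<in> A" "red u' \<noteq> 0" "v' \<in> A" "u' * b = (xi - 1) ^ k * v'"
    using assms(2) unfolding ordge_def by blast
  have "u * u' * (a + b) = u' * (u * a) + u * (u' * b)" by (simp add: algebra_simps)
  also have "\<dots> = (xi - 1) ^ k * (u' * v + u * v')" unfolding 1(5) 2(5) by (simp add: algebra_simps)
  finally show ?thesis using 1 2 by (intro ordgeI[of _ "u * u'" "u' * v + u * v'"]) auto
qed

lemma ordge_sum: "(\<And>x. x \<in> B \<Longrightarrow> ordge k (f x)) \<Longrightarrow> ordge k (sum f B)"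
  by (induction B rule: infinite_finite_induct) (auto simp: ordge_zero ordge_add)

lemma ordge_prod: "(\<And>x. x \<in> B \<Longrightarrow> ordge (k x) (f x)) \<Longrightarrow> ordge (sum k B) (prod f B)"
  by (induction B rule: infinite_finite_induct) (auto simp: ordge_0 ordge_mult)

lemma ordge_cancel:
  assumes "ordge k (b * a)" "b \<in> A" "red b \<noteq> 0" "a \<in> A" shows "ordge k a"
proof -
  obtain u v where 1: "u \<in> A" "red u \<noteq> 0" "v \<in> A" "u * (b * a) = (xi - 1) ^ k * v"
    using assms(1) unfolding ordge_def by blast
  then show ?thesis using assms by (intro ordgeI[of _ "u * b" v]) (auto simp: mult.assoc)
qed

lemma ordge_p: "ordge (p - 1) (of_nat p)"
proof -
  obtain w where w: "w \<in> A" "red w \<noteq> 0" "(xi - 1) ^ (p - 1) = of_nat p * w"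
    by (rule p_associated_power)
  then show ?thesis by (intro ordgeI[of _ w 1]) simp_all
qed

lemma ordge_q: "ordge (s * (p - 1)) (of_nat q)"
proof -
  have "ordge (\<Sum>i<s. p - 1) (\<Prod>i<s. of_nat p)" by (intro ordge_prod ordge_p)
  then show ?thesis by (simp add: q_def)
qed

text \<open>The way back to integers. If the exact power \<open>p ^ m\<close> in \<open>N\<close>
  had \<open>m < K\<close>, cancelling it and applying \<open>red\<close> would make the right side
  0, but the left side is a product of two nonzero residues.\<close>

lemma ordge_of_nat_imp_dvd:
  assumes "ordge ((p - 1) * K) (of_nat N)" shows "p ^ K dvd N"
proof (cases "N = 0")
  case False
  obtain u v where 1: "u \<in> A" "red u \<noteq> 0" "v \<in> A" "u * of_nat N = (xi - 1) ^ ((p - 1) * K) * v"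
    using assms unfolding ordge_def by blast
  obtain w where w: "w \<in> A" "(xi - 1) ^ (p - 1) = of_nat p * w"
    by (rule p_associated_power)
  have eq: "u * of_nat N = of_nat p ^ K * (w ^ K * v)"
    unfolding 1(4) power_mult w(2) by (simp add: power_mult_distrib)
  have "\<not> is_unit p" using prime_p by auto
  with False obtain N' where N': "N = p ^ multiplicity p N * N'" "\<not> p dvd N'"
    using multiplicity_decompose'[of N p] by blast
  define m where "m = multiplicity p N"
  show ?thesis
  proof (cases "K \<le> m")
    case True
    then have "p ^ K dvd p ^ m" by (rule le_imp_power_dvd)
    then show ?thesis using N'(1) by (metis dvd_mult2 m_def)
  next
    case lt: False
    have pK: "(of_nat p :: complex) ^ K = of_nat p ^ m * of_nat p ^ (K - m)"
      using lt by (simp flip: power_add)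
    have "(of_nat N :: complex) = of_nat p ^ m * of_nat N'"
      by (subst N'(1)) (simp add: m_def)
    then have "of_nat p ^ m * (u * of_nat N') = of_nat p ^ m * (of_nat p ^ (K - m) * (w ^ K * v))"
      using eq pK by (simp add: algebra_simps)
    then have "u * of_nat N' = of_nat p ^ (K - m) * (w ^ K * v)" using p_ge_2 by simp
    then have "red (u * of_nat N') = red (of_nat p ^ (K - m) * (w ^ K * v))" by (rule arg_cong)
    moreover have "(of_nat p :: 'a) = 0" by (simp add: of_nat_field_eq_0_iff)
    ultimately have "red u * of_nat N' = 0" using 1 w lt by (simp add: power_0_left)
    then show ?thesis using 1(2) N'(2) by (simp add: of_nat_field_eq_0_iff)
  qed
qed simp

section \<open>Base-\<open>p\<close> digits and their rotations\<close>

definition digit_sum :: "nat \<Rightarrow> nat" where "digit_sum e = (\<Sum>i<s. (e div p ^ i) mod p)"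

lemma digit_sum_rec: "digit_sum e = e mod p + (\<Sum>i<s - 1. (e div p div p ^ i) mod p)"
proof -
  obtain s' where s': "s = Suc s'" using s_pos by (cases s) auto
  show ?thesis unfolding digit_sum_def unfolding s'
    by (subst sum.lessThan_Suc_shift) (simp add: div_mult2_eq)
qed

lemma digit_sum_mult_p: assumes "p * e < q" shows "digit_sum (p * e) = digit_sum e"
proof -
  obtain s' where s': "s = Suc s'" using s_pos by (cases s) auto
  have "e < p ^ s'" using assms unfolding q_def unfolding s' by simp
  then have "digit_sum e = (\<Sum>i<s'. (e div p ^ i) mod p)" unfolding digit_sum_def unfolding s' by simp
  moreover have "s - 1 = s'" by (simp add: s')
  ultimately show ?thesis using p_ge_2 by (simp add: digit_sum_rec[of "p * e"])
qed

lemma digit_sum_Suc: assumes "\<not> p dvd Suc e" shows "digit_sum (Suc e) = Suc (digit_sum e)"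
proof -
  have m: "Suc e mod p = Suc (e mod p)" using assms by (metis dvd_eq_mod_eq_0 mod_Suc)
  have d: "Suc e div p = e div p" using assms by (metis dvd_eq_mod_eq_0 div_Suc)
  show ?thesis unfolding digit_sum_rec m d by simp
qed

lemma digit_sum_0 [simp]: "digit_sum 0 = 0"
  by (simp add: digit_sum_def)

text \<open>For \<open>e < q\<close>, this moves the lowest \<open>t\<close> of the \<open>s\<close>
  base-\<open>p\<close> digits to the top.\<close>

definition rot :: "nat \<Rightarrow> nat \<Rightarrow> nat" where
  "rot t e = e div p ^ t + p ^ (s - t) * (e mod p ^ t)"

text \<open>After multiplication by \<open>p ^ t\<close> the moved digits carry an extra weight
  \<open>q\<close>, which is 1 modulo \<open>q - 1\<close>: rotation acts as division by
  \<open>p ^ t\<close> modulo \<open>q - 1\<close>.\<close>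

lemma rot_cong:
  assumes "t \<le> s" shows "p ^ t * rot t e = e + (q - 1) * (e mod p ^ t)"
proof -
  have "p ^ t * rot t e = p ^ t * (e div p ^ t) + q * (e mod p ^ t)"
    using assms by (simp add: rot_def q_def distrib_left mult.assoc[symmetric] power_add[symmetric])
  also have "q = (q - 1) + 1" using q_ge_2 by simp
  also have "p ^ t * (e div p ^ t) + (q - 1 + 1) * (e mod p ^ t)
      = p ^ t * (e div p ^ t) + e mod p ^ t + (q - 1) * (e mod p ^ t)" by (simp only: distrib_right)
  finally show ?thesis by simp
qed

text \<open>Rotating once more obeys \<open>p * rot (Suc t) e = rot t e + (q - 1) * digit\<close>,
  with the digit at position \<open>t\<close>. Summing over a full cycle, both rotation sums agree
  because \<open>rot 0 e = rot s e\<close>.\<close>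

lemma sum_rot:
  assumes "e < q" shows "(p - 1) * (\<Sum>t<s. rot t e) = (q - 1) * digit_sum e"
proof -
  have step: "p * rot (Suc t) e = rot t e + (q - 1) * ((e div p ^ t) mod p)" if "t < s" for t
  proof -
    have "p ^ t * (p * rot (Suc t) e) = e + (q - 1) * (e mod p ^ Suc t)"
      using rot_cong[of "Suc t" e] that by (simp add: mult.assoc mult.left_commute)
    also have "e mod p ^ Suc t = p ^ t * ((e div p ^ t) mod p) + e mod p ^ t"
      using mod_mult2_eq[of e "p ^ t" p] by (simp add: mult.commute)
    also have "e + (q - 1) * (p ^ t * ((e div p ^ t) mod p) + e mod p ^ t)
        = p ^ t * rot t e + (q - 1) * (p ^ t * ((e div p ^ t) mod p))"
      using rot_cong[of t e] that by (simp add: distrib_left)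
    also have "\<dots> = p ^ t * (rot t e + (q - 1) * ((e div p ^ t) mod p))"
      by (simp add: distrib_left mult.left_commute)
    finally show ?thesis using p_ge_2 by simp
  qed
  have ends: "rot 0 e = e" "rot s e = e" using assms by (simp_all add: rot_def q_def)
  have "p * (\<Sum>t<s. rot (Suc t) e) = (\<Sum>t<s. rot t e) + (q - 1) * digit_sum e"
    by (simp add: sum_distrib_left step sum.distrib digit_sum_def)
  moreover have "(\<Sum>t<s. rot (Suc t) e) = (\<Sum>t<s. rot t e)"
  proof -
    have "rot 0 e + (\<Sum>t<s. rot (Suc t) e) = (\<Sum>t<s. rot t e) + rot s e"
      using sum.lessThan_Suc_shift[of "\<lambda>t. rot t e" s] sum.lessThan_Suc[of "\<lambda>t. rot t e" s]
      by simp
    then show ?thesis by (simp add: ends)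
  qed
  ultimately show ?thesis by (simp add: diff_mult_distrib)
qed

text \<open>All digits of \<open>q - 1\<close> equal \<open>p - 1\<close>, so every rotation fixes
  it and \<open>sum_rot\<close> applies.\<close>

lemma digit_sum_q_minus_1: "digit_sum (q - 1) = s * (p - 1)"
proof -
  have "rot t (q - 1) = q - 1" if "t < s" for t
  proof -
    have pt: "p ^ t * p ^ (s - t) = q" using that by (simp add: q_def flip: power_add)
    have pos: "p ^ t > 0" "p ^ (s - t) > 0" using p_ge_2 by simp_all
    have "P * R - 1 = P * (R - 1) + (P - 1)" if "P > 0" "R > 0" for P R :: nat
      using that by (cases P; cases R) auto
    from this[OF pos] have "q - 1 = p ^ t * (p ^ (s - t) - 1) + (p ^ t - 1)" by (simp only: pt)
    then have "(q - 1) mod p ^ t = (p ^ t - 1) mod p ^ t" by (simp only: mod_mult_self4)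
    also have "\<dots> = p ^ t - 1" using pos by (intro mod_less) linarith
    finally have "(q - 1) mod p ^ t = p ^ t - 1" .
    then have "p ^ t * rot t (q - 1) = (q - 1) * p ^ t"
      using rot_cong[of t "q - 1"] that pos by (cases "p ^ t") auto
    then show ?thesis using p_ge_2 by simp
  qed
  then have "(p - 1) * (s * (q - 1)) = (q - 1) * digit_sum (q - 1)"
    using sum_rot[of "q - 1"] q_ge_2 by simp
  then show ?thesis using q_ge_2 by (simp add: mult.commute)
qed

section \<open>Gauss and Jacobi sums\<close>

text \<open>The inverse makes this the coefficient of \<open>T z ^ e\<close> in the expansion of
  \<open>psi\<close>. As \<open>inverse 0 = 0\<close>, the term at 0 vanishes for
  \<open>e > 0\<close>.\<close>

definition gauss_sum :: "nat \<Rightarrow> complex" where "gauss_sum e = (\<Sum>t\<in>UNIV. psi t * T (inverse t) ^ e)"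

lemma gauss_sum_closed [simp]: "gauss_sum e \<in> A"
  unfolding gauss_sum_def by (intro sum_closed) simp

lemma frobenius_bij: "bij (\<lambda>x :: 'a. x ^ p)"
proof -
  have "inj (\<lambda>x :: 'a. x ^ p)"
  proof (rule injI)
    fix x y :: 'a assume "x ^ p = y ^ p"
    then have "(x ^ p) ^ (p ^ (s - 1)) = (y ^ p) ^ (p ^ (s - 1))" by simp
    moreover have "p * p ^ (s - 1) = q" using s_pos unfolding q_def by (cases s) auto
    ultimately show "x = y" by (simp add: power_q flip: power_mult)
  qed
  then show ?thesis by (simp add: bij_def finite_UNIV_inj_surj)
qed

text \<open>Frobenius permutes the field and fixes \<open>psi\<close>; on the multiplicative
  character it multiplies the exponent by \<open>p\<close>.\<close>

lemma gauss_sum_mult_p: "gauss_sum (p * e) = gauss_sum e"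
proof -
  have "gauss_sum e = (\<Sum>t\<in>UNIV. psi (t ^ p) * T (inverse (t ^ p)) ^ e)"
    unfolding gauss_sum_def using sum.reindex_bij_betw[OF frobenius_bij] by (rule sym)
  also have "\<dots> = gauss_sum (p * e)"
    unfolding gauss_sum_def by (simp add: psi_frobenius T_power power_mult flip: power_inverse)
  finally show ?thesis by simp
qed

definition jacobi_sum :: "nat \<Rightarrow> nat \<Rightarrow> complex" where
  "jacobi_sum a b = (\<Sum>x\<in>UNIV. T (inverse x) ^ a * T (inverse (1 - x)) ^ b)"

text \<open>Group the double sum by \<open>w = t + u\<close>. The convolution \<open>F w\<close>
  scales to the Jacobi sum for nonzero \<open>w\<close>, and vanishes at 0 because
  \<open>q - 1\<close> does not divide \<open>a + b\<close>.\<close>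

lemma gauss_sum_mult:
  assumes "a > 0" "b > 0" "\<not> (q - 1) dvd (a + b)"
  shows "gauss_sum a * gauss_sum b = jacobi_sum a b * gauss_sum (a + b)"
proof -
  define F where "F w = (\<Sum>t\<in>UNIV. T (inverse t) ^ a * T (inverse (w - t)) ^ b)" for w
  have F: "F w = T (inverse w) ^ (a + b) * jacobi_sum a b" for w
  proof (cases "w = 0")
    case True
    have "F w = (\<Sum>t\<in>UNIV. T (- 1) ^ b * T (inverse t) ^ (a + b))"
      unfolding F_def True
    proof (rule sum.cong)
      fix t :: 'a
      have "T (inverse (0 - t)) = T (- 1) * T (inverse t)" by (simp flip: T_mult)
      then show "T (inverse t) ^ a * T (inverse (0 - t)) ^ b = T (- 1) ^ b * T (inverse t) ^ (a + b)"
        by (simp add: power_add power_mult_distrib)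
    qed simp
    also have "\<dots> = 0"
      using assms by (simp add: sum_distrib_left[symmetric] sum_T_inverse_power sum_T_power)
    finally show ?thesis using True assms by simp
  next
    case False
    have "F w = (\<Sum>x\<in>UNIV. T (inverse (w * x)) ^ a * T (inverse (w - w * x)) ^ b)"
      unfolding F_def
      by (rule sum.reindex_bij_witness[of _ "\<lambda>x. w * x" "\<lambda>t. t / w"]) (use False in auto)
    also have "\<dots> = (\<Sum>x\<in>UNIV. T (inverse w) ^ (a + b) * (T (inverse x) ^ a * T (inverse (1 - x)) ^ b))"
    proof (rule sum.cong)
      fix x :: 'a
      have "w - w * x = w * (1 - x)" by (simp add: algebra_simps)
      then have "inverse (w - w * x) = inverse w * inverse (1 - x)" by simp
      then show "T (inverse (w * x)) ^ a * T (inverse (w - w * x)) ^ b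
          = T (inverse w) ^ (a + b) * (T (inverse x) ^ a * T (inverse (1 - x)) ^ b)"
        by (simp add: T_mult power_add power_mult_distrib)
    qed simp
    finally show ?thesis by (simp add: jacobi_sum_def sum_distrib_left)
  qed
  have "gauss_sum a * gauss_sum b = (\<Sum>t\<in>UNIV. \<Sum>u\<in>UNIV. psi (t + u) * T (inverse t) ^ a * T (inverse u) ^ b)"
    unfolding gauss_sum_def sum_product by (simp add: psi_add mult_ac)
  also have "\<dots> = (\<Sum>t\<in>UNIV. \<Sum>w\<in>UNIV. psi w * T (inverse t) ^ a * T (inverse (w - t)) ^ b)"
  proof (rule sum.cong)
    fix t :: 'a
    show "(\<Sum>u\<in>UNIV. psi (t + u) * T (inverse t) ^ a * T (inverse u) ^ b)
        = (\<Sum>w\<in>UNIV. psi w * T (inverse t) ^ a * T (inverse (w - t)) ^ b)"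
      by (rule sum.reindex_bij_witness[of _ "\<lambda>w. w - t" "\<lambda>u. t + u"]) auto
  qed simp
  also have "\<dots> = (\<Sum>w\<in>UNIV. psi w * F w)"
    by (subst sum.swap) (simp add: F_def sum_distrib_left mult.assoc)
  also have "\<dots> = jacobi_sum a b * gauss_sum (a + b)"
    by (simp add: F gauss_sum_def sum_distrib_left mult_ac)
  finally show ?thesis .
qed

lemma sum_inverse_power:
  assumes "k > 0" "k < q - 1" shows "(\<Sum>x\<in>UNIV. inverse (x :: 'a) ^ k) = 0"
proof -
  have "\<not> (q - 1) dvd k" using assms by (auto dest: dvd_imp_le)
  then have "(\<Sum>x\<in>UNIV. T (inverse x) ^ k) = 0"
    using assms by (simp add: sum_T_inverse_power sum_T_power)
  then have "red (\<Sum>x\<in>UNIV. T (inverse x) ^ k) = 0" by simp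
  then show ?thesis by (simp add: red_sum)
qed

text \<open>Induction on \<open>k\<close>. Away from 0 and 1,
  \<open>(inverse x - 1) * inverse (1 - x) = inverse x\<close>, so each step adds a power sum over
  the field without 0 and 1, which is -1; partial fractions give the start -2.\<close>

lemma red_jacobi_sum:
  assumes "k > 0" "k + 1 < q - 1" shows "red (jacobi_sum k 1) = - of_nat (k + 1)"
proof -
  define S where "S k = (\<Sum>x\<in>UNIV. inverse (x :: 'a) ^ k * inverse (1 - x))" for k
  \<comment> \<open>At 0 and 1 the convention \<open>inverse 0 = 0\<close> breaks the identities
    used below, so these points are split off.\<close>
  have split: "(\<Sum>x\<in>UNIV. f x) = f 0 + f 1 + (\<Sum>x\<in>UNIV - {0, 1}. f x)" for f :: "'a \<Rightarrow> 'a"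
  proof -
    have "UNIV = insert 0 (insert 1 (UNIV - {0, 1 :: 'a}))" by auto
    then have "(\<Sum>x\<in>UNIV. f x) = (\<Sum>x\<in>insert 0 (insert 1 (UNIV - {0, 1})). f x)" by simp
    also have "\<dots> = f 0 + (f 1 + (\<Sum>x\<in>UNIV - {0, 1}. f x))"
      by (subst sum.insert, simp, simp, subst sum.insert, simp, simp) simp
    finally show ?thesis by (simp add: add.assoc)
  qed
  have pw: "(\<Sum>x\<in>UNIV - {0, 1 :: 'a}. inverse x ^ j) = - 1" if "j > 0" "j < q - 1" for j
    using split[of "\<lambda>x. inverse x ^ j"] sum_inverse_power[OF that] that
    by (simp add: power_0_left eq_neg_iff_add_eq_0 add.commute)
  have "S k = - of_nat (k + 1)" using assms
  proof (induction k rule: nat_induct_non_zero)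
    case 1
    have "S 1 = (\<Sum>x\<in>UNIV - {0, 1}. inverse x * inverse (1 - x))"
      unfolding S_def by (subst split) simp
    also have "\<dots> = (\<Sum>x\<in>UNIV - {0, 1}. inverse x + inverse (1 - x))"
      by (rule sum.cong) (auto simp: field_simps)
    also have "\<dots> = (\<Sum>x\<in>UNIV - {0, 1}. inverse x ^ 1) + (\<Sum>x\<in>UNIV - {0, 1}. inverse (1 - x))"
      by (simp add: sum.distrib)
    also have "(\<Sum>x\<in>UNIV - {0, 1 :: 'a}. inverse (1 - x)) = (\<Sum>x\<in>UNIV - {0, 1}. inverse x ^ 1)"
      by (rule sum.reindex_bij_witness[of _ "\<lambda>x. 1 - x" "\<lambda>x. 1 - x"]) auto
    also have "(\<Sum>x\<in>UNIV - {0, 1 :: 'a}. inverse x ^ 1) = - 1"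
      using 1 by (intro pw) auto
    finally show ?case by simp
  next
    case (Suc j)
    have "S (Suc j) - S j = (\<Sum>x\<in>UNIV - {0, 1}. inverse x ^ Suc j * inverse (1 - x) - inverse x ^ j * inverse (1 - x))"
      unfolding S_def sum_subtractf[symmetric] using Suc.hyps by (subst split) (simp add: power_0_left)
    also have "\<dots> = (\<Sum>x\<in>UNIV - {0, 1}. inverse x ^ Suc j)"
    proof (rule sum.cong)
      fix x :: 'a assume x: "x \<in> UNIV - {0, 1}"
      have "inverse x ^ Suc j * inverse (1 - x) - inverse x ^ j * inverse (1 - x)
          = inverse x ^ j * ((inverse x - 1) * inverse (1 - x))" by (simp add: algebra_simps)
      also have "(inverse x - 1) * inverse (1 - x) = inverse x" using x by (simp add: field_simps)
      finally show "inverse x ^ Suc j * inverse (1 - x) - inverse x ^ j * inverse (1 - x) = inverse x ^ Suc j"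
        by simp
    qed simp
    also have "\<dots> = - 1" using Suc.prems by (intro pw) auto
    finally have "S (Suc j) = S j - 1" by (simp add: algebra_simps)
    with Suc show ?case by simp
  qed
  moreover have "red (jacobi_sum k 1) = S k" unfolding jacobi_sum_def S_def by (simp add: red_sum)
  ultimately show ?thesis by simp
qed

lemma jacobi_sum_closed [simp]: "jacobi_sum a b \<in> A"
  unfolding jacobi_sum_def by (intro sum_closed) simp

text \<open>The lower bound in Stickelberger's theorem: the Jacobi sum relating \<open>gauss_sum k * gauss_sum 1\<close> to
  \<open>gauss_sum (k + 1)\<close> is a unit whenever adding 1 to \<open>k\<close> produces no carry.\<close>

lemma ordge_gauss_sum: "e > 0 \<Longrightarrow> e < q - 1 \<Longrightarrow> ordge (digit_sum e) (gauss_sum e)"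
proof (induction e rule: less_induct)
  case (less e)
  have ordge_1: "ordge 1 (gauss_sum 1)" if "1 < q - 1"
  proof -
    \<comment> \<open>This allows \<open>psi t\<close> to be replaced by \<open>psi t - 1\<close>,
      which is divisible by \<open>xi - 1\<close>.\<close>
    have "(\<Sum>t\<in>UNIV. T (inverse t)) = 0"
      using that sum_T_power[of 1] sum_T_inverse_power[of 1] by (auto dest: dvd_imp_le)
    then have "gauss_sum 1 = (\<Sum>t\<in>UNIV. (psi t - 1) * T (inverse t))"
      by (simp add: gauss_sum_def algebra_simps sum_subtractf)
    moreover have "ordge 1 ((psi t - 1) * T (inverse t))" for t
    proof -
      obtain v where "v \<in> A" "psi t - 1 = (xi - 1) * v" using psi_minus_1 by blast
      then show ?thesis using ordge_uniformizer[of "v * T (inverse t)" 1] by (simp add: mult.assoc)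
    qed
    ultimately show ?thesis by (simp add: ordge_sum)
  qed
  show ?case
  proof (cases "p dvd e")
    \<comment> \<open>Dividing by \<open>p\<close> changes neither the digit sum nor the Gauss
      sum.\<close>
    case True
    then obtain e' where e': "e = p * e'" by auto
    with less.prems p_ge_2 have "e' > 0" "e' < e" by auto
    moreover have "p * e' < q" using less.prems e' by simp
    ultimately show ?thesis
      unfolding e' gauss_sum_mult_p by (subst digit_sum_mult_p) (use less e' in auto)
  next
    case False
    obtain k where k: "e = Suc k" using less.prems by (cases e) auto
    show ?thesis
    proof (cases "k = 0")
      case True
      then show ?thesis using ordge_1 less.prems k digit_sum_Suc[of 0] False by simp
    next
      case k0: False
      have "\<not> (q - 1) dvd (k + 1)" using less.prems k by (auto dest: dvd_imp_le)
      then have "gauss_sum k * gauss_sum 1 = jacobi_sum k 1 * gauss_sum e" using gauss_sum_mult[of k 1] k0 k by simp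
      moreover have "ordge (digit_sum k + 1) (gauss_sum k * gauss_sum 1)"
        using less k k0 by (intro ordge_mult ordge_1) auto
      moreover have "red (jacobi_sum k 1) \<noteq> 0"
      proof -
        have "red (jacobi_sum k 1) = - of_nat e" using red_jacobi_sum[of k] less.prems k k0 by simp
        then show ?thesis using False by (simp add: of_nat_field_eq_0_iff)
      qed
      ultimately have "ordge (digit_sum k + 1) (gauss_sum e)" using ordge_cancel[of _ "jacobi_sum k 1" "gauss_sum e"] by simp
      then show ?thesis using digit_sum_Suc[of k] False k by simp
    qed
  qed
qed

section \<open>The additive character as a polynomial in Teichmueller representatives\<close>

text \<open>At exponent 0 the multiplicative Fourier coefficient -1 is raised by \<open>q\<close>,
  offset by \<open>- q\<close> at exponent \<open>q - 1\<close>: nothing changes for nonzero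
  \<open>z\<close>, and the value at 0 becomes correct.\<close>

definition psi_coeff :: "nat \<Rightarrow> complex" where
  "psi_coeff e = (if e = 0 then of_nat (q - 1) else if e = q - 1 then - of_nat q else gauss_sum e)"

lemma ordge_psi_coeff: assumes "e \<le> q - 1" shows "ordge (digit_sum e) (psi_coeff e)"
proof -
  have "ordge (digit_sum (q - 1)) (- of_nat q)"
    using ordge_mult[OF ordge_q ordge_0[of "- 1"]] unfolding digit_sum_q_minus_1 by simp
  then show ?thesis using assms ordge_gauss_sum[of e] by (auto simp: psi_coeff_def ordge_0)
qed

lemma psi_coeff_closed [simp]: "psi_coeff e \<in> A"
  by (simp add: psi_coeff_def)

text \<open>Fourier inversion on the unit group. The factor \<open>q - 1\<close> stays on the left
  to avoid denominators.\<close>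

lemma psi_expansion: "of_nat (q - 1) * psi z = (\<Sum>e\<le>q - 1. psi_coeff e * T z ^ e)"
proof (cases "z = 0")
  case True
  have "(\<Sum>e\<le>q - 1. psi_coeff e * T z ^ e) = (\<Sum>e\<in>{0}. psi_coeff e * T z ^ e)"
    by (rule sum.mono_neutral_right) (auto simp: True)
  then show ?thesis by (simp add: True psi_coeff_def)
next
  case False
  define n where "n = q - 1"
  have n0: "n > 0" using q_ge_2 by (simp add: n_def)
  define G where "G e = (\<Sum>t\<in>UNIV - {0}. psi t * T (inverse t) ^ e)" for e
  have G: "psi_coeff e = G e + (if e = 0 then of_nat q else 0)" if "e < n" for e
  proof (cases "e = 0")
    case True
    have "(\<Sum>t\<in>UNIV. psi t) = 0" using sum_psi_mult[of 1] by simp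
    then have "G 0 = - 1" using sum.remove[of UNIV 0 psi] by (simp add: G_def eq_neg_iff_add_eq_0 add.commute)
    then show ?thesis using True q_ge_2 by (simp add: psi_coeff_def of_nat_diff)
  next
    case False
    have "gauss_sum e = G e" unfolding gauss_sum_def G_def using False by (intro sum.mono_neutral_right) auto
    then show ?thesis using False that by (simp add: psi_coeff_def n_def)
  qed
  have geo: "(\<Sum>e<n. T b ^ e) = (if b = 1 then of_nat n else 0)" if "b \<noteq> 0" for b
  proof (cases "b = 1")
    case False
    have "(T b - 1) * (\<Sum>e<n. T b ^ e) = 0"
      using T_power_q_minus_1[OF that] by (simp add: n_def flip: power_diff_1_eq)
    moreover have "T b \<noteq> 1" using False T_eq_iff[of b 1] by simp
    ultimately show ?thesis using False by simp
  qed simp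
  have "(\<Sum>e<n. G e * T z ^ e) = (\<Sum>t\<in>UNIV - {0}. psi t * (\<Sum>e<n. T (inverse t * z) ^ e))"
    unfolding G_def sum_distrib_right sum_distrib_left
    by (subst sum.swap) (simp add: T_mult power_mult_distrib mult.assoc)
  also have "\<dots> = (\<Sum>t\<in>UNIV - {0}. if t = z then psi z * of_nat n else 0)"
    using False by (intro sum.cong) (auto simp: geo field_simps)
  also have "\<dots> = psi z * of_nat n" using False by (simp add: sum.delta)
  finally have GT: "(\<Sum>e<n. G e * T z ^ e) = psi z * of_nat n" .
  have "(\<Sum>e\<le>n. psi_coeff e * T z ^ e) = (\<Sum>e<n. psi_coeff e * T z ^ e) + psi_coeff n * T z ^ n"
    using lessThan_Suc_atMost[of n] sum.lessThan_Suc[of "\<lambda>e. psi_coeff e * T z ^ e" n] by simp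
  also have "(\<Sum>e<n. psi_coeff e * T z ^ e) = (\<Sum>e<n. G e * T z ^ e + (if e = 0 then of_nat q else 0))"
    by (intro sum.cong) (auto simp: G distrib_right)
  also have "\<dots> = psi z * of_nat n + of_nat q" using n0 by (simp add: sum.distrib GT sum.delta)
  also have "psi_coeff n * T z ^ n = - of_nat q"
    using n0 T_power_q_minus_1[OF False] by (simp add: psi_coeff_def n_def)
  finally show ?thesis by (simp add: n_def mult.commute)
qed

end

section \<open>Exponential sums\<close>

lemma prod_monomial_power:
  fixes x :: "'i \<Rightarrow> 'b::comm_semiring_1"
  shows "(\<Prod>k\<in>K. (\<Prod>i\<in>X. x i ^ w k i) ^ e k) = (\<Prod>i\<in>X. x i ^ (\<Sum>k\<in>K. e k * w k i))"
  unfolding power_sum prod_power_distrib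
  by (subst prod.swap) (simp add: power_mult[symmetric] mult.commute)

context teichmueller
begin

text \<open>Modulo \<open>q - 1\<close>, rotation divides every \<open>e k\<close> by the same unit
  \<open>p ^ t\<close>.\<close>

lemma rot_dvd:
  assumes "t \<le> s" "(q - 1) dvd (\<Sum>k\<in>K. e k * w k)"
  shows "(q - 1) dvd (\<Sum>k\<in>K. rot t (e k) * w k)"
proof -
  have "p ^ t * (\<Sum>k\<in>K. rot t (e k) * w k) = (\<Sum>k\<in>K. (p ^ t * rot t (e k)) * w k)"
    by (simp add: sum_distrib_left mult.assoc)
  also have "\<dots> = (\<Sum>k\<in>K. e k * w k) + (q - 1) * (\<Sum>k\<in>K. (e k mod p ^ t) * w k)"
    by (simp only: rot_cong[OF assms(1)] distrib_right sum.distrib sum_distrib_left mult.assoc)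
  finally have "(q - 1) dvd p ^ t * (\<Sum>k\<in>K. rot t (e k) * w k)" using assms(2) by simp
  moreover have "coprime (q - 1) (p ^ t)"
  proof -
    have "coprime (q - 1) q" using q_ge_2 by (intro coprime_diff_one_left_nat) simp
    moreover have "p dvd q" using s_pos by (simp add: q_def)
    ultimately have "coprime (q - 1) p" by (metis coprime_divisors dvd_refl)
    then show ?thesis by simp
  qed
  ultimately show ?thesis by (simp add: coprime_dvd_mult_right_iff)
qed

lemma rot_eq_0_iff: assumes "t \<le> s" shows "rot t e = 0 \<longleftrightarrow> e = 0"
proof
  assume "rot t e = 0"
  then show "e = 0" using rot_cong[OF assms, of e] by simp
qed (simp add: rot_def)

lemma ordge_sum_T_power:
  assumes "(q - 1) dvd k"
  shows "ordge (if k = 0 then s * (p - 1) else 0) (\<Sum>x\<in>UNIV. T x ^ k)"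
  using assms ordge_q by (simp add: sum_T_power ordge_0)

lemma sum_PiE_monomial:
  assumes "finite X"
  shows "(\<Sum>x\<in>PiE X (\<lambda>_. UNIV). \<Prod>i\<in>X. T (x i) ^ k i) = (\<Prod>i\<in>X. \<Sum>t\<in>UNIV. T t ^ k i)"
  by (rule prod_sum_PiE[symmetric]) (use assms in auto)

text \<open>A single exponent not divisible by \<open>q - 1\<close> makes the product 0, which has
  every order \<open>l\<close>. Otherwise each exponent 0 contributes a factor \<open>q\<close>, of
  order \<open>s * (p - 1)\<close>.\<close>

lemma ordge_prod_sum_T_power:
  assumes "finite X"
  shows "ordge (if \<forall>i\<in>X. (q - 1) dvd k i then s * (p - 1) * card {i\<in>X. k i = 0} else l)
           (\<Prod>i\<in>X. \<Sum>t\<in>UNIV. T t ^ k i)"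
proof (cases "\<forall>i\<in>X. (q - 1) dvd k i")
  case True
  have "ordge (\<Sum>i\<in>X. if k i = 0 then s * (p - 1) else 0) (\<Prod>i\<in>X. \<Sum>t\<in>UNIV. T t ^ k i)"
    by (intro ordge_prod ordge_sum_T_power) (use True in blast)
  moreover have "(\<Sum>i\<in>X. if k i = 0 then s * (p - 1) else 0) = s * (p - 1) * card {i\<in>X. k i = 0}"
    using assms by (simp add: sum.If_cases Int_def)
  ultimately show ?thesis using True by simp
next
  case False
  then obtain i where "i \<in> X" "\<not> (q - 1) dvd k i" by blast
  moreover from this have "(\<Sum>t\<in>UNIV. T t ^ k i) = 0" by (auto simp: sum_T_power)
  ultimately have "(\<Prod>i\<in>X. \<Sum>t\<in>UNIV. T t ^ k i) = 0" using assms by (auto intro: prod_zero)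
  then show ?thesis using False ordge_zero by simp
qed

text \<open>Averaging the hypothesis over the \<open>s\<close> cyclic rotations of the base-\<open>p\<close> digits of \<open>e\<close>
  turns the bound on \<open>\<Sum>k. e k\<close> into one on digit sums.\<close>

lemma digit_sum_bound:
  fixes e :: "'k \<Rightarrow> nat"
  assumes bound: "\<And>e :: 'k \<Rightarrow> nat.
      (\<And>i. i \<in> X \<Longrightarrow> (q - 1) dvd (\<Sum>k\<in>K. e k * w k i)) \<Longrightarrow>
      (\<And>j. j \<in> Y \<Longrightarrow> (q - 1) dvd (\<Sum>k\<in>K. e k * u k j)) \<Longrightarrow>
      (q - 1) * B \<le> (\<Sum>k\<in>K. e k) + (q - 1) *
        (card {i\<in>X. (\<Sum>k\<in>K. e k * w k i) = 0} + card {j\<in>Y. (\<Sum>k\<in>K. e k * u k j) = 0})"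
    and K: "finite K" and e: "\<And>k. k \<in> K \<Longrightarrow> e k < q"
    and X: "\<And>i. i \<in> X \<Longrightarrow> (q - 1) dvd (\<Sum>k\<in>K. e k * w k i)"
    and Y: "\<And>j. j \<in> Y \<Longrightarrow> (q - 1) dvd (\<Sum>k\<in>K. e k * u k j)"
  shows "s * (p - 1) * B \<le> (\<Sum>k\<in>K. digit_sum (e k)) + s * (p - 1) *
      (card {i\<in>X. (\<Sum>k\<in>K. e k * w k i) = 0} + card {j\<in>Y. (\<Sum>k\<in>K. e k * u k j) = 0})"
proof -
  define c where "c = card {i\<in>X. (\<Sum>k\<in>K. e k * w k i) = 0} + card {j\<in>Y. (\<Sum>k\<in>K. e k * u k j) = 0}"
  have step: "(q - 1) * B \<le> (\<Sum>k\<in>K. rot t (e k)) + (q - 1) * c" if "t < s" for t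
  proof -
    have t: "t \<le> s" using that by simp
    \<comment> \<open>Rotation fixes the set of absent variables, so \<open>c\<close> is the same
      for all \<open>t\<close>.\<close>
    have z: "(\<Sum>k\<in>K. rot t (e k) * v k) = 0 \<longleftrightarrow> (\<Sum>k\<in>K. e k * v k) = 0" for v
      using K by (simp add: rot_eq_0_iff[OF t])
    have "(q - 1) * B \<le> (\<Sum>k\<in>K. rot t (e k)) + (q - 1) *
        (card {i\<in>X. (\<Sum>k\<in>K. rot t (e k) * w k i) = 0} + card {j\<in>Y. (\<Sum>k\<in>K. rot t (e k) * u k j) = 0})"
      by (intro bound rot_dvd[OF t] X Y)
    then show ?thesis by (simp only: z c_def)
  qed
  have "(\<Sum>t<s. (q - 1) * B) \<le> (\<Sum>t<s. (\<Sum>k\<in>K. rot t (e k)) + (q - 1) * c)"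
    by (intro sum_mono step) simp
  also have "\<dots> = (\<Sum>k\<in>K. \<Sum>t<s. rot t (e k)) + s * (q - 1) * c"
    by (simp add: sum.distrib sum.swap[of _ K])
  finally have "(p - 1) * (s * (q - 1) * B) \<le> (p - 1) * ((\<Sum>k\<in>K. \<Sum>t<s. rot t (e k)) + s * (q - 1) * c)"
    by (intro mult_left_mono) simp_all
  also have "\<dots> = (\<Sum>k\<in>K. (p - 1) * (\<Sum>t<s. rot t (e k))) + (p - 1) * (s * (q - 1) * c)"
    by (simp add: distrib_left sum_distrib_left)
  also have "(\<Sum>k\<in>K. (p - 1) * (\<Sum>t<s. rot t (e k))) = (q - 1) * (\<Sum>k\<in>K. digit_sum (e k))"
    unfolding sum_distrib_left[of "q - 1"] by (intro sum.cong refl sum_rot e)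
  finally have "(q - 1) * (s * (p - 1) * B) \<le> (q - 1) * ((\<Sum>k\<in>K. digit_sum (e k)) + s * (p - 1) * c)"
    by (simp add: distrib_left mult_ac)
  then show ?thesis using q_ge_2 unfolding c_def by simp
qed

text \<open>Expanding each \<open>psi\<close> factor and summing over \<open>x\<close> and
  \<open>y\<close> first turns the sum into one over exponent families \<open>e\<close>. Each term
  either vanishes or has an order given by digit sums plus one \<open>q\<close> per absent variable,
  which \<open>digit_sum_bound\<close> estimates.\<close>

theorem ordge_exponential_sum:
  fixes a :: "'k \<Rightarrow> 'a"
  assumes fin: "finite K" "finite X" "finite Y"
    and bound: "\<And>e :: 'k \<Rightarrow> nat.
      (\<And>i. i \<in> X \<Longrightarrow> (q - 1) dvd (\<Sum>k\<in>K. e k * w k i)) \<Longrightarrow>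
      (\<And>j. j \<in> Y \<Longrightarrow> (q - 1) dvd (\<Sum>k\<in>K. e k * u k j)) \<Longrightarrow>
      (q - 1) * B \<le> (\<Sum>k\<in>K. e k) + (q - 1) *
        (card {i\<in>X. (\<Sum>k\<in>K. e k * w k i) = 0} + card {j\<in>Y. (\<Sum>k\<in>K. e k * u k j) = 0})"
  shows "ordge (s * (p - 1) * B)
    (\<Sum>x\<in>PiE X (\<lambda>_. UNIV). \<Sum>y\<in>PiE Y (\<lambda>_. UNIV).
       psi (\<Sum>k\<in>K. a k * (\<Prod>i\<in>X. x i ^ w k i) * (\<Prod>j\<in>Y. y j ^ u k j)))"
    (is "ordge _ ?S")
proof -
  define E where "E = PiE K (\<lambda>_. {..q - 1})"
  define W where "W e i = (\<Sum>k\<in>K. e k * w k i)" for e :: "'k \<Rightarrow> nat" and i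
  define U where "U e j = (\<Sum>k\<in>K. e k * u k j)" for e :: "'k \<Rightarrow> nat" and j
  define c where "c e = (\<Prod>k\<in>K. psi_coeff (e k) * T (a k) ^ e k)" for e
  have expand: "of_nat (q - 1) ^ card K *
        psi (\<Sum>k\<in>K. a k * (\<Prod>i\<in>X. x i ^ w k i) * (\<Prod>j\<in>Y. y j ^ u k j))
      = (\<Sum>e\<in>E. c e * ((\<Prod>i\<in>X. T (x i) ^ W e i) * (\<Prod>j\<in>Y. T (y j) ^ U e j)))" for x y
  proof -
    let ?t = "\<lambda>k. a k * (\<Prod>i\<in>X. x i ^ w k i) * (\<Prod>j\<in>Y. y j ^ u k j)"
    have "of_nat (q - 1) ^ card K * psi (\<Sum>k\<in>K. ?t k) = (\<Prod>k\<in>K. of_nat (q - 1) * psi (?t k))"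
      by (simp add: psi_sum prod.distrib)
    also have "\<dots> = (\<Prod>k\<in>K. \<Sum>e\<le>q - 1. psi_coeff e * T (?t k) ^ e)"
      by (simp only: psi_expansion)
    also have "\<dots> = (\<Sum>e\<in>E. \<Prod>k\<in>K. psi_coeff (e k) * T (?t k) ^ e k)"
      unfolding E_def by (rule prod_sum_PiE) (use fin in auto)
    also have "\<dots> = (\<Sum>e\<in>E. c e * ((\<Prod>i\<in>X. T (x i) ^ W e i) * (\<Prod>j\<in>Y. T (y j) ^ U e j)))"
    proof (rule sum.cong)
      fix e
      have "T (?t k) = T (a k) * (\<Prod>i\<in>X. T (x i) ^ w k i) * (\<Prod>j\<in>Y. T (y j) ^ u k j)" for k
        by (simp add: T_mult T_prod T_power)
      then show "(\<Prod>k\<in>K. psi_coeff (e k) * T (?t k) ^ e k)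
          = c e * ((\<Prod>i\<in>X. T (x i) ^ W e i) * (\<Prod>j\<in>Y. T (y j) ^ U e j))"
        by (simp add: c_def W_def U_def power_mult_distrib prod.distrib mult.assoc
            flip: prod_monomial_power)
    qed simp
    finally show ?thesis .
  qed
  have "of_nat (q - 1) ^ card K * ?S = (\<Sum>x\<in>PiE X (\<lambda>_. UNIV). \<Sum>y\<in>PiE Y (\<lambda>_. UNIV). \<Sum>e\<in>E.
      c e * ((\<Prod>i\<in>X. T (x i) ^ W e i) * (\<Prod>j\<in>Y. T (y j) ^ U e j)))"
    by (simp only: sum_distrib_left expand)
  also have "\<dots> = (\<Sum>x\<in>PiE X (\<lambda>_. UNIV). \<Sum>e\<in>E. \<Sum>y\<in>PiE Y (\<lambda>_. UNIV).
      c e * ((\<Prod>i\<in>X. T (x i) ^ W e i) * (\<Prod>j\<in>Y. T (y j) ^ U e j)))"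
    by (intro sum.cong refl sum.swap)
  also have "\<dots> = (\<Sum>e\<in>E. \<Sum>x\<in>PiE X (\<lambda>_. UNIV). \<Sum>y\<in>PiE Y (\<lambda>_. UNIV).
      c e * ((\<Prod>i\<in>X. T (x i) ^ W e i) * (\<Prod>j\<in>Y. T (y j) ^ U e j)))"
    by (rule sum.swap)
  also have "\<dots> = (\<Sum>e\<in>E. c e *
      ((\<Prod>i\<in>X. \<Sum>t\<in>UNIV. T t ^ W e i) * (\<Prod>j\<in>Y. \<Sum>t\<in>UNIV. T t ^ U e j)))"
    unfolding sum_PiE_monomial[OF fin(2), symmetric] sum_PiE_monomial[OF fin(3), symmetric] sum_product
    by (simp only: sum_distrib_left)
  finally have S: "of_nat (q - 1) ^ card K * ?S = \<dots>" .
  have "ordge (s * (p - 1) * B) (c e *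
      ((\<Prod>i\<in>X. \<Sum>t\<in>UNIV. T t ^ W e i) * (\<Prod>j\<in>Y. \<Sum>t\<in>UNIV. T t ^ U e j)))" if "e \<in> E" for e
  proof -
    have e: "e k \<le> q - 1" if "k \<in> K" for k using \<open>e \<in> E\<close> that by (auto simp: E_def PiE_def)
    have c: "ordge (\<Sum>k\<in>K. digit_sum (e k)) (c e)"
      unfolding c_def
    proof (rule ordge_prod)
      fix k assume "k \<in> K"
      then show "ordge (digit_sum (e k)) (psi_coeff (e k) * T (a k) ^ e k)"
        using ordge_mult[OF ordge_psi_coeff[OF e] ordge_0[of "T (a k) ^ e k"]] by simp
    qed
    note x = ordge_prod_sum_T_power[OF fin(2), where k = "W e" and l = "s * (p - 1) * B"]
    note y = ordge_prod_sum_T_power[OF fin(3), where k = "U e" and l = "s * (p - 1) * B"]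
    show ?thesis
    proof (cases "(\<forall>i\<in>X. (q - 1) dvd W e i) \<and> (\<forall>j\<in>Y. (q - 1) dvd U e j)")
      case True
      have "s * (p - 1) * B \<le> (\<Sum>k\<in>K. digit_sum (e k)) + s * (p - 1) *
          (card {i\<in>X. W e i = 0} + card {j\<in>Y. U e j = 0})"
        unfolding W_def U_def
      proof (rule digit_sum_bound[OF bound fin(1)])
        show "e k < q" if "k \<in> K" for k using e[OF that] q_ge_2 by simp
      qed (use True in \<open>auto simp: W_def U_def\<close>)
      then show ?thesis
        using ordge_mult[OF c ordge_mult[OF x y]] True
        by (elim ordge_mono) (simp add: distrib_left)
    next
      case False
      then show ?thesis
        using ordge_mult[OF c ordge_mult[OF x y]]
        by (elim ordge_mono) auto
    qed
  qed
  then have "ordge (s * (p - 1) * B) (of_nat (q - 1) ^ card K * ?S)"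
    unfolding S by (rule ordge_sum)
  then show ?thesis
  proof (rule ordge_cancel)
    \<comment> \<open>The normalizing factor reduces to a power of -1, so it can be
      cancelled.\<close>
    have "(of_nat (q - 1) :: 'a) = - 1" using q_ge_2 of_nat_q by (simp add: of_nat_diff)
    then show "red (of_nat (q - 1) ^ card K) \<noteq> 0" by simp
  qed (auto intro!: sum_closed)
qed

end

section \<open>Counting zeros\<close>

text \<open>The multiplicities \<open>\<Gamma> m\<close> may exceed the bound \<open>q - 1\<close>
  in the definition of \<open>omega\<close>. Reducing them modulo \<open>q - 1\<close> preserves the
  congruence and positivity and does not increase the sum.\<close>

lemma omega_le:
  fixes f :: "'a::{field,finite} poly" and \<Gamma> :: "nat \<Rightarrow> nat"
  assumes dvd: "(CARD('a) - 1) dvd (\<Sum>m\<in>exponents f. m * \<Gamma> m)"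
    and pos: "(\<Sum>m\<in>exponents f. m * \<Gamma> m) \<noteq> 0"
  shows "omega f \<le> (\<Sum>m\<in>exponents f. \<Gamma> m)"
proof -
  define n where "n = CARD('a) - 1"
  have n: "n > 0" using card_field_ge_2[where 'a = 'a] by (simp add: n_def)
  \<comment> \<open>The residue of \<open>\<Gamma> m\<close> modulo \<open>n\<close> in \<open>{1..n}\<close>, so that nonzero entries stay nonzero.\<close>
  define \<gamma> where "\<gamma> m = (if \<Gamma> m = 0 then 0 else Suc ((\<Gamma> m - 1) mod n))" for m
  have \<gamma>_n: "\<gamma> m \<le> n" for m using n by (simp add: \<gamma>_def Suc_le_eq)
  have split: "\<Gamma> m = \<gamma> m + n * ((\<Gamma> m - 1) div n)" for m
  proof (cases "\<Gamma> m")
    case (Suc k)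
    then show ?thesis by (simp add: \<gamma>_def)
  qed (simp add: \<gamma>_def)
  have "(\<Sum>m\<in>exponents f. m * \<Gamma> m)
      = (\<Sum>m\<in>exponents f. m * \<gamma> m + n * (m * ((\<Gamma> m - 1) div n)))"
    by (intro sum.cong refl) (metis split distrib_left mult.left_commute)
  also have "\<dots> = (\<Sum>m\<in>exponents f. m * \<gamma> m) + n * (\<Sum>m\<in>exponents f. m * ((\<Gamma> m - 1) div n))"
    by (simp only: sum.distrib sum_distrib_left)
  finally have "n dvd (\<Sum>m\<in>exponents f. m * \<gamma> m)"
    using dvd by (metis dvd_add_times_triv_right_iff mult.commute n_def)
  then obtain k where k: "(\<Sum>m\<in>exponents f. m * \<gamma> m) = n * k" by (rule dvdE)
  have "(\<Sum>m\<in>exponents f. m * \<gamma> m) \<noteq> 0"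
  proof -
    obtain m where m: "m \<in> exponents f" "m * \<Gamma> m \<noteq> 0" using pos by (auto simp: finite_exponents)
    then have "m * \<gamma> m \<noteq> 0" by (simp add: \<gamma>_def)
    then show ?thesis using m(1) by (auto simp: finite_exponents)
  qed
  then have "k > 0" using k by (cases k) auto
  then have "(\<Sum>m\<in>exponents f. \<gamma> m) \<in> omega_sums f"
    unfolding omega_sums_def using k \<gamma>_n by (fastforce simp: n_def)
  then have "omega f \<le> (\<Sum>m\<in>exponents f. \<gamma> m)"
    unfolding omega_def by (intro Min_le finite_omega_sums)
  also have "\<dots> \<le> (\<Sum>m\<in>exponents f. \<Gamma> m)"
    by (intro sum_mono) (metis split le_add1)
  finally show ?thesis .
qed

section \<open>Monomials arising from products of the \<open>f i\<close>\<close>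

definition monomials :: "'i set \<Rightarrow> ('i \<Rightarrow> 'a::zero poly) \<Rightarrow> nat \<Rightarrow> ('i \<Rightarrow> nat) set" where
  "monomials I f d = {w. \<exists>\<kappa>. (\<forall>i\<in>I. w i = (\<Sum>m\<in>exponents (f i). m * \<kappa> i m)) \<and>
      (\<Sum>i\<in>I. \<Sum>m\<in>exponents (f i). \<kappa> i m) \<le> d}"

text \<open>Terms form a list, possibly with repeated exponent vectors, so sums are concatenations
  and nothing has to be collected.\<close>

definition term_eval :: "'i set \<Rightarrow> ('a::comm_ring_1 \<times> ('i \<Rightarrow> nat)) list \<Rightarrow> ('i \<Rightarrow> 'a) \<Rightarrow> 'a" where
  "term_eval I L x = (\<Sum>(a, w)\<leftarrow>L. a * (\<Prod>i\<in>I. x i ^ w i))"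

text \<open>\<open>F\<close> is a combination of monomials occurring in products of at most \<open>d\<close> of the polynomials
  \<open>f\<^sub>i(x\<^sub>i)\<close>; \<open>\<kappa> i m\<close> counts the factors contributing \<open>x\<^sub>i\<^sup>m\<close>.\<close>

definition representable ::
    "'i set \<Rightarrow> ('i \<Rightarrow> 'a::comm_ring_1 poly) \<Rightarrow> nat \<Rightarrow> (('i \<Rightarrow> 'a) \<Rightarrow> 'a) \<Rightarrow> bool" where
  "representable I f d F \<longleftrightarrow> (\<exists>L. snd ` set L \<subseteq> monomials I f d \<and> F = term_eval I L)"

lemma monomials_add:
  assumes "v \<in> monomials I f d" "w \<in> monomials I f e"
  shows "(\<lambda>i. v i + w i) \<in> monomials I f (d + e)"
proof -
  obtain \<kappa> where 1: "\<forall>i\<in>I. v i = (\<Sum>m\<in>exponents (f i). m * \<kappa> i m)"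
      "(\<Sum>i\<in>I. \<Sum>m\<in>exponents (f i). \<kappa> i m) \<le> d"
    using assms(1) by (auto simp: monomials_def)
  obtain \<kappa>' where 2: "\<forall>i\<in>I. w i = (\<Sum>m\<in>exponents (f i). m * \<kappa>' i m)"
      "(\<Sum>i\<in>I. \<Sum>m\<in>exponents (f i). \<kappa>' i m) \<le> e"
    using assms(2) by (auto simp: monomials_def)
  show ?thesis unfolding monomials_def
    by (intro CollectI exI[of _ "\<lambda>i m. \<kappa> i m + \<kappa>' i m"])
      (use 1 2 in \<open>simp add: sum.distrib distrib_left\<close>)
qed

lemma monomials_mono: "d \<le> e \<Longrightarrow> monomials I f d \<subseteq> monomials I f e"
  by (fastforce simp: monomials_def)

lemma representable_mono: "representable I f d F \<Longrightarrow> d \<le> e \<Longrightarrow> representable I f e F"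
  unfolding representable_def using monomials_mono by blast

lemma representable_const: "representable I f d (\<lambda>x. c)"
proof -
  have "(\<lambda>_. 0) \<in> monomials I f d" by (auto simp: monomials_def intro!: exI[of _ "\<lambda>_ _. 0"])
  then show ?thesis
    unfolding representable_def by (intro exI[of _ "[(c, \<lambda>_. 0)]"]) (auto simp: term_eval_def)
qed

lemma representable_add:
  assumes "representable I f d F" "representable I f d G"
  shows "representable I f d (\<lambda>x. F x + G x)"
proof -
  obtain L M where LM: "snd ` set L \<subseteq> monomials I f d" "F = term_eval I L"
      "snd ` set M \<subseteq> monomials I f d" "G = term_eval I M"
    using assms unfolding representable_def by blast
  have "(\<lambda>x. F x + G x) = term_eval I (L @ M)" by (simp add: LM term_eval_def fun_eq_iff)
  moreover have "snd ` set (L @ M) \<subseteq> monomials I f d" using LM by auto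
  ultimately show ?thesis unfolding representable_def by blast
qed

lemma representable_sum:
  "(\<And>k. k \<in> K \<Longrightarrow> representable I f d (F k)) \<Longrightarrow> representable I f d (\<lambda>x. \<Sum>k\<in>K. F k x)"
  by (induction K rule: infinite_finite_induct) (auto intro: representable_const representable_add)

lemma representable_mult:
  fixes F G :: "('i \<Rightarrow> 'a::comm_ring_1) \<Rightarrow> 'a"
  assumes "representable I f d F" "representable I f e G"
  shows "representable I f (d + e) (\<lambda>x. F x * G x)"
proof -
  obtain L M where LM: "snd ` set L \<subseteq> monomials I f d" "F = term_eval I L"
      "snd ` set M \<subseteq> monomials I f e" "G = term_eval I M"
    using assms unfolding representable_def by blast
  define mul where "mul t = (\<lambda>t'. (fst t * fst t', \<lambda>i. snd t i + snd t' i))"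
    for t t' :: "'a \<times> ('i \<Rightarrow> nat)"
  have one: "term_eval I (map (mul t) M) x = fst t * (\<Prod>i\<in>I. x i ^ snd t i) * term_eval I M x"
    for t M x
    by (induction M) (auto simp: term_eval_def mul_def power_add prod.distrib algebra_simps)
  have "term_eval I (concat (map (\<lambda>t. map (mul t) M) L)) x = term_eval I L x * term_eval I M x" for x
  proof (induction L)
    case (Cons t L)
    have "term_eval I (concat (map (\<lambda>t. map (mul t) M) (t # L))) x
        = term_eval I (map (mul t) M) x + term_eval I (concat (map (\<lambda>t. map (mul t) M) L)) x"
      by (simp add: term_eval_def)
    also have "\<dots> = term_eval I (t # L) x * term_eval I M x"
      unfolding Cons.IH one by (simp add: term_eval_def case_prod_beta distrib_right)
    finally show ?case .
  qed (simp add: term_eval_def)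
  then have "(\<lambda>x. F x * G x) = term_eval I (concat (map (\<lambda>t. map (mul t) M) L))"
    by (simp add: LM fun_eq_iff)
  moreover have "snd ` set (concat (map (\<lambda>t. map (mul t) M) L)) \<subseteq> monomials I f (d + e)"
    using LM(1,3) by (force simp: mul_def image_subset_iff intro!: monomials_add)
  ultimately show ?thesis unfolding representable_def by blast
qed

lemma representable_power:
  "representable I f d F \<Longrightarrow> representable I f (n * d) (\<lambda>x. F x ^ n)"
  by (induction n) (auto intro: representable_const representable_mult)

lemma representable_prod:
  "(\<And>k. k \<in> K \<Longrightarrow> representable I f (d k) (F k)) \<Longrightarrow>
    representable I f (\<Sum>k\<in>K. d k) (\<lambda>x. \<Prod>k\<in>K. F k x)"
  by (induction K rule: infinite_finite_induct) (auto intro: representable_const representable_mult)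

lemma poly_exponents:
  fixes g :: "'a::comm_ring_1 poly"
  shows "poly g y = (\<Sum>m\<in>exponents g. coeff g m * y ^ m)"
  unfolding poly_altdef
  by (rule sum.mono_neutral_right) (auto simp: exponents_def intro: le_degree)

lemma representable_poly:
  fixes f :: "'i \<Rightarrow> 'a::comm_ring_1 poly"
  assumes "i \<in> I" "finite I"
  shows "representable I f 1 (\<lambda>x. poly (f i) (x i))"
  unfolding poly_exponents
proof (rule representable_sum)
  fix m assume m: "m \<in> exponents (f i)"
  define w where "w j = (if j = i then m else 0)" for j
  have "w \<in> monomials I f 1"
  proof -
    define \<kappa> :: "'i \<Rightarrow> nat \<Rightarrow> nat" where "\<kappa> j n = (if j = i then if n = m then 1 else 0 else 0)" for j n
    have "(\<Sum>n\<in>exponents (f j). n * \<kappa> j n) = w j" for j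
    proof (cases "j = i")
      case True
      then have "(\<Sum>n\<in>exponents (f j). n * \<kappa> j n) = (\<Sum>n\<in>exponents (f i). if n = m then m else 0)"
        by (intro sum.cong) (auto simp: \<kappa>_def)
      then show ?thesis using m True by (simp add: w_def finite_exponents)
    qed (simp add: \<kappa>_def w_def)
    moreover have "(\<Sum>n\<in>exponents (f j). \<kappa> j n) = (if j = i then 1 else 0)" for j
      using m by (cases "j = i") (simp_all add: \<kappa>_def finite_exponents)
    ultimately show ?thesis
      unfolding monomials_def using assms by (intro CollectI exI[of _ \<kappa>]) simp
  qed
  moreover have "(\<Prod>j\<in>I. x j ^ w j) = x i ^ m" for x :: "'i \<Rightarrow> 'a"
  proof -
    have "(\<Prod>j\<in>I. x j ^ w j) = (\<Prod>j\<in>I. if j = i then x i ^ m else 1)"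
      by (intro prod.cong) (auto simp: w_def)
    then show ?thesis using assms by simp
  qed
  ultimately show "representable I f 1 (\<lambda>x. coeff (f i) m * x i ^ m)"
    unfolding representable_def
    by (intro exI[of _ "[(coeff (f i) m, w)]"]) (auto simp: term_eval_def fun_eq_iff)
qed

text \<open>Factors in the coordinates outside \<open>I\<close>, fixed at \<open>c\<close>, are
  absorbed into the coefficient \<open>C\<close>; only the \<open>I\<close>-degree counts
  factors.\<close>

lemma representable_mpoly_eval:
  fixes P :: "('n::finite, 'a::comm_ring_1) mpoly"
  shows "representable I f (deg_on I P)
    (\<lambda>x. mpoly_eval P (\<lambda>i. poly (f i) (if i \<in> I then x i else c i)))"
  unfolding mpoly_eval_def
proof (rule representable_sum)
  fix m assume m: "m \<in> Poly_Mapping.keys P"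
  define C where "C = Poly_Mapping.lookup P m *
      (\<Prod>i\<in>- I. poly (f i) (c i) ^ Poly_Mapping.lookup m i)"
  have "representable I f (0 + (\<Sum>i\<in>I. Poly_Mapping.lookup m i * 1))
      (\<lambda>x. C * (\<Prod>i\<in>I. poly (f i) (x i) ^ Poly_Mapping.lookup m i))"
    by (intro representable_mult representable_const representable_prod representable_power
        representable_poly) auto
  moreover have "(\<Sum>i\<in>I. Poly_Mapping.lookup m i) \<le> deg_on I P"
    unfolding deg_on_def using m by (intro Max_ge) auto
  ultimately have "representable I f (deg_on I P)
      (\<lambda>x. C * (\<Prod>i\<in>I. poly (f i) (x i) ^ Poly_Mapping.lookup m i))"
    by (auto intro: representable_mono)
  moreover have "C * (\<Prod>i\<in>I. poly (f i) (x i) ^ Poly_Mapping.lookup m i)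
      = Poly_Mapping.lookup P m *
        (\<Prod>i\<in>UNIV. poly (f i) (if i \<in> I then x i else c i) ^ Poly_Mapping.lookup m i)" for x
  proof -
    have "(\<Prod>i\<in>UNIV. poly (f i) (if i \<in> I then x i else c i) ^ Poly_Mapping.lookup m i)
        = (\<Prod>i\<in>I \<union> - I. poly (f i) (if i \<in> I then x i else c i) ^ Poly_Mapping.lookup m i)"
      by simp
    also have "\<dots> = (\<Prod>i\<in>I. poly (f i) (x i) ^ Poly_Mapping.lookup m i) *
        (\<Prod>i\<in>- I. poly (f i) (c i) ^ Poly_Mapping.lookup m i)"
      by (subst prod.union_disjoint) (auto intro!: arg_cong2[where f = "(*)"] prod.cong)
    finally show ?thesis by (simp add: C_def mult_ac)
  qed
  ultimately show "representable I f (deg_on I P) (\<lambda>x. Poly_Mapping.lookup P m *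
        (\<Prod>i\<in>UNIV. poly (f i) (if i \<in> I then x i else c i) ^ Poly_Mapping.lookup m i))"
    by simp
qed

section \<open>The weight inequality and the count of zeros\<close>

context teichmueller
begin

text \<open>The index \<open>(j, l)\<close> is the \<open>l\<close>-th term of the
  \<open>j\<close>-th polynomial, taken \<open>e (j, l)\<close> times. A variable of nonzero total
  degree uses at least \<open>omega (f i)\<close> factors, and the supply is at most the sum of
  \<open>a j * d j\<close>. The condition on \<open>\<mu>\<close> encodes the ceiling without
  division.\<close>

lemma weight_bound:
  fixes f :: "'i \<Rightarrow> 'a poly" and e :: "'j \<times> nat \<Rightarrow> nat" and w :: "'j \<times> nat \<Rightarrow> 'i \<Rightarrow> nat"
  assumes I: "finite I" and J: "finite J"
    and deg: "\<And>i. i \<in> I \<Longrightarrow> degree (f i) > 0"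
    and w: "\<And>j l. j \<in> J \<Longrightarrow> l < n j \<Longrightarrow> w (j, l) \<in> monomials I f (d j)"
    and D: "\<And>j. j \<in> J \<Longrightarrow> d j \<le> D" "D \<ge> 1"
    and \<mu>: "\<And>m. (\<Sum>i\<in>I. omega (f i)) \<le> (q - 1) * ((\<Sum>j\<in>J. d j) + D * m) \<Longrightarrow> \<mu> \<le> m"
    and K: "K = Sigma J (\<lambda>j. {..<n j})"
    and dvd_I: "\<And>i. i \<in> I \<Longrightarrow> (q - 1) dvd (\<Sum>k\<in>K. e k * w k i)"
    and dvd_J: "\<And>j. j \<in> J \<Longrightarrow> (q - 1) dvd (\<Sum>k\<in>K. e k * (if j = fst k then 1 else 0))"
  shows "(q - 1) * (card J + \<mu>) \<le> (\<Sum>k\<in>K. e k) + (q - 1) *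
      (card {i\<in>I. (\<Sum>k\<in>K. e k * w k i) = 0} +
       card {j\<in>J. (\<Sum>k\<in>K. e k * (if j = fst k then 1 else 0)) = 0})"
proof -
  have finK: "finite K" using J by (simp add: K)
  define W where "W i = (\<Sum>k\<in>K. e k * w k i)" for i
  define a where "a j = (\<Sum>l<n j. e (j, l))" for j
  have U: "(\<Sum>k\<in>K. e k * (if j = fst k then 1 else 0)) = a j" if "j \<in> J" for j
  proof -
    have "(\<Sum>k\<in>K. e k * (if j = fst k then 1 else 0))
        = (\<Sum>j'\<in>J. \<Sum>l<n j'. e (j', l) * (if j = j' then 1 else 0))"
      unfolding K by (subst sum.Sigma) (use J in \<open>auto simp: case_prod_beta\<close>)
    also have "\<dots> = (\<Sum>j'\<in>J. if j = j' then a j' else 0)"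
      by (intro sum.cong) (auto simp: a_def)
    also have "\<dots> = a j" using that J by simp
    finally show ?thesis .
  qed
  define \<alpha> where "\<alpha> j = a j div (q - 1)" for j
  have a: "a j = (q - 1) * \<alpha> j" if "j \<in> J" for j
    using dvd_J[OF that] that by (simp add: \<alpha>_def U)
  define c where "c = card {i\<in>I. W i = 0}"
  have "\<forall>k\<in>K. \<exists>\<kappa>. (\<forall>i\<in>I. w k i = (\<Sum>m\<in>exponents (f i). m * \<kappa> i m)) \<and>
      (\<Sum>i\<in>I. \<Sum>m\<in>exponents (f i). \<kappa> i m) \<le> d (fst k)"
    using w by (auto simp: K monomials_def)
  then obtain \<kappa> where \<kappa>: "\<And>k i. k \<in> K \<Longrightarrow> i \<in> I \<Longrightarrow> w k i = (\<Sum>m\<in>exponents (f i). m * \<kappa> k i m)"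
      "\<And>k. k \<in> K \<Longrightarrow> (\<Sum>i\<in>I. \<Sum>m\<in>exponents (f i). \<kappa> k i m) \<le> d (fst k)"
    unfolding bchoice_iff by blast
  \<comment> \<open>\<open>\<Gamma> i m\<close> counts, with the multiplicities \<open>e\<close>,
    how often the term of exponent \<open>m\<close> of \<open>f i\<close> is used.\<close>
  define \<Gamma> where "\<Gamma> i m = (\<Sum>k\<in>K. e k * \<kappa> k i m)" for i m
  have W: "W i = (\<Sum>m\<in>exponents (f i). m * \<Gamma> i m)" if "i \<in> I" for i
  proof -
    have "W i = (\<Sum>k\<in>K. \<Sum>m\<in>exponents (f i). e k * (m * \<kappa> k i m))"
      unfolding W_def using \<kappa>(1) that by (simp add: sum_distrib_left)
    also have "\<dots> = (\<Sum>m\<in>exponents (f i). \<Sum>k\<in>K. e k * (m * \<kappa> k i m))" by (rule sum.swap)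
    finally show ?thesis by (simp add: \<Gamma>_def sum_distrib_left mult.left_commute)
  qed
  \<comment> \<open>An absent variable is charged \<open>q - 1\<close>, the largest possible value
    of \<open>omega\<close>.\<close>
  have omega: "omega (f i) \<le> (if W i = 0 then q - 1 else 0) + (\<Sum>m\<in>exponents (f i). \<Gamma> i m)"
    if i: "i \<in> I" for i
  proof (cases "W i = 0")
    case True
    then show ?thesis using omega_bounds(2)[OF deg[OF i]] by (simp add: card_q)
  next
    case False
    then show ?thesis
      using omega_le[where f = "f i" and \<Gamma> = "\<Gamma> i"] dvd_I[OF i] W[OF i] by (simp add: card_q W_def)
  qed
  have "(\<Sum>i\<in>I. omega (f i)) \<le> (\<Sum>i\<in>I. (if W i = 0 then q - 1 else 0) + (\<Sum>m\<in>exponents (f i). \<Gamma> i m))"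
    by (intro sum_mono omega)
  also have "\<dots> = (q - 1) * c + (\<Sum>i\<in>I. \<Sum>m\<in>exponents (f i). \<Gamma> i m)"
    using I by (simp add: sum.distrib c_def sum.If_cases Int_def)
  also have "(\<Sum>i\<in>I. \<Sum>m\<in>exponents (f i). \<Gamma> i m)
      = (\<Sum>k\<in>K. e k * (\<Sum>i\<in>I. \<Sum>m\<in>exponents (f i). \<kappa> k i m))"
    by (simp add: \<Gamma>_def sum_distrib_left sum.swap[of _ K])
  also have "\<dots> \<le> (\<Sum>k\<in>K. e k * d (fst k))"
    by (intro sum_mono mult_left_mono \<kappa>(2)) auto
  also have "(\<Sum>k\<in>K. e k * d (fst k)) = (\<Sum>j\<in>J. a j * d j)"
    unfolding K a_def sum_distrib_right
    by (subst sum.Sigma) (use J in \<open>auto simp: case_prod_beta\<close>)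
  also have "\<dots> = (q - 1) * (\<Sum>j\<in>J. \<alpha> j * d j)"
    by (simp add: a sum_distrib_left mult.assoc)
  finally have "(\<Sum>i\<in>I. omega (f i)) \<le> (q - 1) * (c + (\<Sum>j\<in>J. \<alpha> j * d j))"
    by (simp add: distrib_left)
  also have "\<dots> \<le> (q - 1) * ((\<Sum>j\<in>J. d j) + D * (c + (\<Sum>j\<in>J. \<alpha> j - 1)))"
  proof (rule mult_left_mono)
    \<comment> \<open>Subtraction is truncated: for \<open>\<alpha> j = 0\<close> the term
      \<open>d j\<close> alone remains as slack.\<close>
    have "\<alpha> j * d j \<le> d j + D * (\<alpha> j - 1)" if "j \<in> J" for j
    proof (cases "\<alpha> j")
      case (Suc b)
      then show ?thesis using mult_right_mono[OF D(1)[OF that], of b] by (simp add: mult.commute)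
    qed simp
    then have "(\<Sum>j\<in>J. \<alpha> j * d j) \<le> (\<Sum>j\<in>J. d j + D * (\<alpha> j - 1))" by (rule sum_mono)
    also have "\<dots> = (\<Sum>j\<in>J. d j) + D * (\<Sum>j\<in>J. \<alpha> j - 1)"
      by (simp add: sum.distrib sum_distrib_left)
    finally have "(\<Sum>j\<in>J. \<alpha> j * d j) \<le> (\<Sum>j\<in>J. d j) + D * (\<Sum>j\<in>J. \<alpha> j - 1)" .
    moreover have "c \<le> D * c" using D(2) by simp
    ultimately show "c + (\<Sum>j\<in>J. \<alpha> j * d j) \<le> (\<Sum>j\<in>J. d j) + D * (c + (\<Sum>j\<in>J. \<alpha> j - 1))"
      unfolding distrib_left by linarith
  qed simp
  finally have \<mu>_le: "\<mu> \<le> c + (\<Sum>j\<in>J. \<alpha> j - 1)" by (rule \<mu>)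
  define c' where "c' = card {j\<in>J. a j = 0}"
  have "card J + (\<Sum>j\<in>J. \<alpha> j - 1) = (\<Sum>j\<in>J. 1 + (\<alpha> j - 1))"
    unfolding sum.distrib by simp
  \<comment> \<open>The truncation costs 1 exactly when \<open>y j\<close> is absent, which is what
    \<open>c'\<close> counts.\<close>
  also have "\<dots> = (\<Sum>j\<in>J. \<alpha> j + (if a j = 0 then 1 else 0))"
  proof (rule sum.cong)
    fix j assume "j \<in> J"
    then show "1 + (\<alpha> j - 1) = \<alpha> j + (if a j = 0 then 1 else 0)"
      using a[of j] q_ge_2 by (cases "\<alpha> j") auto
  qed simp
  also have "\<dots> = (\<Sum>j\<in>J. \<alpha> j) + c'"
    using J by (simp add: sum.distrib c'_def sum.If_cases Int_def)
  finally have "card J + \<mu> \<le> (\<Sum>j\<in>J. \<alpha> j) + (c + c')" using \<mu>_le by simp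
  then have "(q - 1) * (card J + \<mu>) \<le> (q - 1) * ((\<Sum>j\<in>J. \<alpha> j) + (c + c'))"
    by (rule mult_left_mono) simp
  also have "\<dots> = (\<Sum>j\<in>J. a j) + (q - 1) * (c + c')"
    by (simp add: distrib_left sum_distrib_left a)
  also have "(\<Sum>j\<in>J. a j) = (\<Sum>k\<in>K. e k)"
    unfolding K a_def by (subst sum.Sigma) (use J in auto)
  also have "c' = card {j\<in>J. (\<Sum>k\<in>K. e k * (if j = fst k then 1 else 0)) = 0}"
    unfolding c'_def using U by (intro arg_cong[where f = card]) auto
  finally show ?thesis by (simp only: c_def W_def)
qed

lemma sum_psi_linear:
  assumes "finite J"
  shows "(\<Sum>y\<in>PiE J (\<lambda>_. UNIV). psi (\<Sum>j\<in>J. y j * z j)) =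
    (if \<forall>j\<in>J. z j = 0 then of_nat q ^ card J else 0)"
proof -
  have "(\<Sum>y\<in>PiE J (\<lambda>_. UNIV). psi (\<Sum>j\<in>J. y j * z j)) = (\<Prod>j\<in>J. \<Sum>t\<in>UNIV. psi (t * z j))"
    unfolding psi_sum by (rule prod_sum_PiE[symmetric]) (use assms in auto)
  also have "\<dots> = (\<Prod>j\<in>J. if z j = 0 then of_nat q else 0)" by (simp only: sum_psi_mult)
  also have "\<dots> = (if \<forall>j\<in>J. z j = 0 then of_nat q ^ card J else 0)"
    using assms by (auto intro: prod_zero)
  finally show ?thesis .
qed

text \<open>Summing over \<open>y\<close> detects common zeros, so the exponential sum is
  \<open>q ^ card J\<close> times their number. Its order yields the divisor
  \<open>q ^ (card J + \<mu>)\<close>, and the auxiliary power cancels.\<close>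

theorem power_dvd_card_zeros:
  fixes f :: "'i \<Rightarrow> 'a poly" and Q :: "'j \<Rightarrow> ('i \<Rightarrow> 'a) \<Rightarrow> 'a"
  assumes I: "finite I" and J: "finite J"
    and deg: "\<And>i. i \<in> I \<Longrightarrow> degree (f i) > 0"
    and Q: "\<And>j. j \<in> J \<Longrightarrow> representable I f (d j) (Q j)"
    and D: "\<And>j. j \<in> J \<Longrightarrow> d j \<le> D" "D \<ge> 1"
    and \<mu>: "\<And>m. (\<Sum>i\<in>I. omega (f i)) \<le> (q - 1) * ((\<Sum>j\<in>J. d j) + D * m) \<Longrightarrow> \<mu> \<le> m"
  shows "q ^ \<mu> dvd card {x \<in> PiE I (\<lambda>_. UNIV). \<forall>j\<in>J. Q j x = 0}"
proof -
  define Z where "Z = {x \<in> PiE I (\<lambda>_. UNIV). \<forall>j\<in>J. Q j x = 0}"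
  have "\<forall>j\<in>J. \<exists>L. snd ` set L \<subseteq> monomials I f (d j) \<and> Q j = term_eval I L"
    using Q unfolding representable_def by blast
  then obtain L where L: "\<And>j. j \<in> J \<Longrightarrow> snd ` set (L j) \<subseteq> monomials I f (d j)"
      "\<And>j. j \<in> J \<Longrightarrow> Q j = term_eval I (L j)"
    unfolding bchoice_iff by blast
  define K where "K = Sigma J (\<lambda>j. {..<length (L j)})"
  define a where "a k = fst (L (fst k) ! snd k)" for k
  define w where "w k = snd (L (fst k) ! snd k)" for k
  \<comment> \<open>Each term of the \<open>j\<close>-th polynomial carries exactly one factor
    \<open>y j\<close>.\<close>
  define u where "u k j = (if j = fst k then 1 else 0 :: nat)" for k :: "'j \<times> nat" and j
  have inner: "(\<Sum>k\<in>K. a k * (\<Prod>i\<in>I. x i ^ w k i) * (\<Prod>j\<in>J. y j ^ u k j)) = (\<Sum>j\<in>J. y j * Q j x)"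
    for x y
  proof -
    have "(\<Sum>k\<in>K. a k * (\<Prod>i\<in>I. x i ^ w k i) * (\<Prod>j\<in>J. y j ^ u k j))
        = (\<Sum>k\<in>K. y (fst k) * (a k * (\<Prod>i\<in>I. x i ^ w k i)))"
    proof (rule sum.cong)
      fix k assume "k \<in> K"
      then have k: "fst k \<in> J" by (auto simp: K_def)
      have "(\<Prod>j\<in>J. y j ^ u k j) = (\<Prod>j\<in>J. if j = fst k then y j else 1)"
        by (intro prod.cong) (auto simp: u_def)
      then show "a k * (\<Prod>i\<in>I. x i ^ w k i) * (\<Prod>j\<in>J. y j ^ u k j)
          = y (fst k) * (a k * (\<Prod>i\<in>I. x i ^ w k i))"
        using k J by simp
    qed simp
    also have "\<dots> = (\<Sum>j\<in>J. \<Sum>l<length (L j). y j * (fst (L j ! l) * (\<Prod>i\<in>I. x i ^ snd (L j ! l) i)))"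
      unfolding K_def a_def w_def by (subst sum.Sigma) (use J in \<open>auto simp: case_prod_beta\<close>)
    also have "\<dots> = (\<Sum>j\<in>J. y j * Q j x)"
      by (intro sum.cong refl)
        (simp add: L(2) term_eval_def sum_list_sum_nth case_prod_beta sum_distrib_left atLeast0LessThan)
    finally show ?thesis .
  qed
  have "ordge (s * (p - 1) * (card J + \<mu>))
    (\<Sum>x\<in>PiE I (\<lambda>_. UNIV). \<Sum>y\<in>PiE J (\<lambda>_. UNIV).
       psi (\<Sum>k\<in>K. a k * (\<Prod>i\<in>I. x i ^ w k i) * (\<Prod>j\<in>J. y j ^ u k j)))"
  proof (rule ordge_exponential_sum[OF _ I J])
    show "finite K" using J by (simp add: K_def)
    have mon: "w (j, l) \<in> monomials I f (d j)" if "j \<in> J" "l < length (L j)" for j l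
      using L(1)[OF that(1)] nth_mem[OF that(2)] by (auto simp: w_def)
    show "(q - 1) * (card J + \<mu>) \<le> (\<Sum>k\<in>K. e k) + (q - 1) *
        (card {i\<in>I. (\<Sum>k\<in>K. e k * w k i) = 0} + card {j\<in>J. (\<Sum>k\<in>K. e k * u k j) = 0})"
      if "\<And>i. i \<in> I \<Longrightarrow> (q - 1) dvd (\<Sum>k\<in>K. e k * w k i)"
        "\<And>j. j \<in> J \<Longrightarrow> (q - 1) dvd (\<Sum>k\<in>K. e k * u k j)" for e
      using that unfolding u_def by (intro weight_bound[where f = f and d = d and D = D and n = "\<lambda>j. length (L j)"]
          I J deg mon D \<mu> K_def)
  qed
  also have "(\<Sum>x\<in>PiE I (\<lambda>_. UNIV). \<Sum>y\<in>PiE J (\<lambda>_. UNIV).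
       psi (\<Sum>k\<in>K. a k * (\<Prod>i\<in>I. x i ^ w k i) * (\<Prod>j\<in>J. y j ^ u k j)))
      = (\<Sum>x\<in>PiE I (\<lambda>_. UNIV). if \<forall>j\<in>J. Q j x = 0 then of_nat q ^ card J else 0)"
    by (simp only: inner sum_psi_linear[OF J])
  also have "\<dots> = of_nat (q ^ card J * card Z)"
    using I by (simp add: Z_def sum.If_cases finite_PiE Int_def)
  finally have "ordge ((p - 1) * (s * (card J + \<mu>))) (of_nat (q ^ card J * card Z))"
    by (simp only: mult_ac)
  then have "p ^ (s * (card J + \<mu>)) dvd q ^ card J * card Z"
    by (rule ordge_of_nat_imp_dvd)
  then have "q ^ card J * q ^ \<mu> dvd q ^ card J * card Z"
    by (simp only: power_mult power_add flip: q_def)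
  then show ?thesis using q_ge_2 by (simp add: Z_def)
qed

end

section \<open>Reduction to fibres over the coordinates outside \<open>I\<close>\<close>

theorem theorem1p14:
  fixes p s q r :: nat
    and P :: "nat \<Rightarrow> ('n::finite, 'a::{field,finite}) mpoly"
    and f :: "'n \<Rightarrow> 'a poly"
    and I :: "'n set"
  assumes "prime p" and "q = p ^ s" and "CARD('a) = q"
    and "r \<ge> 1"
    and "\<And>j. j \<in> {1..r} \<Longrightarrow> P j \<noteq> 0"
    and "I \<noteq> {}"
    and "Max ((\<lambda>j. deg_on I (P j)) ` {1..r}) > 0"
    and "\<And>i. i \<in> I \<Longrightarrow> degree (f i) > 0"
    and "(q - 1) * (\<Sum>j=1..r. deg_on I (P j)) < (\<Sum>i\<in>I. omega (f i))"
  shows "q ^ nat \<lceil>((\<Sum>i\<in>I. real (omega (f i)) / (real q - 1)) - real (\<Sum>j=1..r. deg_on I (P j)))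
                   / real (Max ((\<lambda>j. deg_on I (P j)) ` {1..r}))\<rceil>
         dvd card {x :: 'n \<Rightarrow> 'a. \<forall>j\<in>{1..r}. mpoly_eval (P j) (\<lambda>i. poly (f i) (x i)) = 0}"
proof -
  obtain A and red :: "complex \<Rightarrow> 'a" and T xi where "teichmueller p s A red T xi"
    using teichmueller_exists[OF assms(1)] assms(2,3) by blast
  then interpret teichmueller p s A red T xi .
  have q_eq: "q = local.q" using assms(2) by (simp add: q_def)
  have q2: "q \<ge> 2" using q_ge_2 q_eq by simp
  define d where "d j = deg_on I (P j)" for j
  define D where "D = Max ((\<lambda>j. deg_on I (P j)) ` {1..r})"
  define \<mu> where "\<mu> = nat \<lceil>((\<Sum>i\<in>I. real (omega (f i)) / (real q - 1)) - real (\<Sum>j=1..r. d j)) / real D\<rceil>"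
  have D: "D \<ge> 1" "\<And>j. j \<in> {1..r} \<Longrightarrow> d j \<le> D" using assms(7) by (auto simp: D_def d_def)
  \<comment> \<open>The ceiling is the least natural number satisfying this integer
    inequality.\<close>
  have \<mu>: "\<mu> \<le> m" if "(\<Sum>i\<in>I. omega (f i)) \<le> (q - 1) * ((\<Sum>j=1..r. d j) + D * m)" for m
  proof -
    have "real (\<Sum>i\<in>I. omega (f i)) \<le> real ((q - 1) * ((\<Sum>j=1..r. d j) + D * m))"
      using that by (simp only: of_nat_le_iff)
    also have "\<dots> = (real q - 1) * (real (\<Sum>j=1..r. d j) + real D * real m)"
      using q2 by (simp add: of_nat_diff)
    finally have "real (\<Sum>i\<in>I. omega (f i)) / (real q - 1) \<le> real (\<Sum>j=1..r. d j) + real D * real m"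
      using q2 by (simp add: divide_le_eq mult.commute)
    then have "((\<Sum>i\<in>I. real (omega (f i)) / (real q - 1)) - real (\<Sum>j=1..r. d j)) / real D \<le> real m"
      using D(1) by (simp add: divide_le_eq mult.commute sum_divide_distrib)
    then show ?thesis unfolding \<mu>_def by (simp add: nat_le_iff ceiling_le_iff)
  qed
  define S where "S = {x :: 'n \<Rightarrow> 'a. \<forall>j\<in>{1..r}. mpoly_eval (P j) (\<lambda>i. poly (f i) (x i)) = 0}"
  define fibre where "fibre c = {x\<in>S. \<forall>i\<in>- I. x i = c i}" for c
  have "q ^ \<mu> dvd card (fibre c)" for c
  proof -
    define Z where "Z = {x \<in> PiE I (\<lambda>_. UNIV). \<forall>j\<in>{1..r}.
        mpoly_eval (P j) (\<lambda>i. poly (f i) (if i \<in> I then x i else c i)) = 0}"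
    have "bij_betw (\<lambda>x i. if i \<in> I then x i else c i) Z (fibre c)"
    proof (rule bij_betw_byWitness[where f' = "\<lambda>x. restrict x I"])
      show "(\<lambda>x. restrict x I) ` fibre c \<subseteq> Z"
      proof
        fix y assume "y \<in> (\<lambda>x. restrict x I) ` fibre c"
        then obtain x where x: "x \<in> fibre c" "y = restrict x I" by blast
        then have "(\<lambda>i. if i \<in> I then y i else c i) = x" by (auto simp: fibre_def fun_eq_iff)
        then have "poly (f i) (if i \<in> I then y i else c i) = poly (f i) (x i)" for i by metis
        then have "mpoly_eval (P j) (\<lambda>i. poly (f i) (if i \<in> I then y i else c i))
            = mpoly_eval (P j) (\<lambda>i. poly (f i) (x i))" for j by (simp only:)
        moreover have "y \<in> PiE I (\<lambda>_. UNIV)" by (simp add: x(2))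
        ultimately show "y \<in> Z" using x(1) by (simp add: Z_def fibre_def S_def)
      qed
    qed (auto simp: Z_def fibre_def S_def PiE_def extensional_def fun_eq_iff)
    then have "card (fibre c) = card Z" by (simp add: bij_betw_same_card)
    moreover have "local.q ^ \<mu> dvd card Z" unfolding Z_def
      by (rule power_dvd_card_zeros[where d = d and D = D])
        (use assms(8) D \<mu> in \<open>auto simp: d_def q_eq intro: representable_mpoly_eval\<close>)
    ultimately show ?thesis by (simp add: q_eq)
  qed
  \<comment> \<open>Functions \<open>c\<close> that agree outside \<open>I\<close> define the same
    fibre, so the partition is taken over the set \<open>range fibre\<close>.\<close>
  moreover have "fibre c = fibre c' \<or> fibre c \<inter> fibre c' = {}" for c c'
    by (auto simp: fibre_def)
  moreover have "S = \<Union>(range fibre)" by (auto simp: fibre_def)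
  ultimately have "q ^ \<mu> dvd card S" using dvd_partition[of "range fibre" "q ^ \<mu>"] by auto
  then show ?thesis by (simp only: S_def \<mu>_def d_def D_def)
qed

end
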